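(* Let $A\subset\mathbb{R}^m$ and $B\subset\mathbb{R}^n$ be unbounded semialgebraic subsets. If $A$ and $B$ are bi-Lipschitz homeomorphic at infinity, then their tangent cones at infinity $C_\infty(A)$ and $C_\infty(B)$ are bi-Lipschitz homeomorphic.
   Context: Subsets carry the Euclidean induced metric. $A$ and $B$ are bi-Lipschitz homeomorphic at infinity if there exist compact sets $K\subset\mathbb{R}^m$, $\widetilde K\subset\mathbb{R}^n$ and a bi-Lipschitz homeomorphism $A\setminus K\to B\setminus\widetilde K$ (Lipschitz with Lipschitz inverse). For an unbounded $X\subset\mathbb{R}^m$, a set $E$ is a tangent cone of $X$ at infinity if there exist positive reals $t_j\to+\infty$ and $D\subset\mathbb{S}^{m-1}$ with $D$ the Hausdorff limit of $\frac{1}{t_j}(X\cap\{\|x\|=t_j\})$ and $E=\{tv:v\in D,t\ge0\}$. An unbounded semialgebraic set has a unique tangent cone at infinity, denoted $C_\infty(X)$. *)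

theory Defs
  imports "HOL-Analysis.Analysis"
begin

inductive_set poly_fun :: "(real ^ 'n \<Rightarrow> real) set" where
  pf_const: "(\<lambda>x. c) \<in> poly_fun"
| pf_coord: "(\<lambda>x. x $ i) \<in> poly_fun"
| pf_add: "p \<in> poly_fun \<Longrightarrow> q \<in> poly_fun \<Longrightarrow> (\<lambda>x. p x + q x) \<in> poly_fun"
| pf_mult: "p \<in> poly_fun \<Longrightarrow> q \<in> poly_fun \<Longrightarrow> (\<lambda>x. p x * q x) \<in> poly_fun"

inductive_set semialgebraic :: "(real ^ 'n) set set" where
  sa_zero: "p \<in> poly_fun \<Longrightarrow> {x. p x = 0} \<in> semialgebraic"
| sa_pos: "p \<in> poly_fun \<Longrightarrow> {x. p x > 0} \<in> semialgebraic"
| sa_compl: "S \<in> semialgebraic \<Longrightarrow> - S \<in> semialgebraic"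
| sa_union: "S \<in> semialgebraic \<Longrightarrow> T \<in> semialgebraic \<Longrightarrow> S \<union> T \<in> semialgebraic"
| sa_inter: "S \<in> semialgebraic \<Longrightarrow> T \<in> semialgebraic \<Longrightarrow> S \<inter> T \<in> semialgebraic"

definition bilipschitz_homeomorphic :: "'a::metric_space set \<Rightarrow> 'b::metric_space set \<Rightarrow> bool" where
  "bilipschitz_homeomorphic S T \<longleftrightarrow>
     (\<exists>f g. homeomorphism S T f g \<and> (\<exists>C. C-lipschitz_on S f) \<and> (\<exists>C. C-lipschitz_on T g))"

definition bilipschitz_homeomorphic_at_infinity ::
  "'a::metric_space set \<Rightarrow> 'b::metric_space set \<Rightarrow> bool" where
  "bilipschitz_homeomorphic_at_infinity A B \<longleftrightarrow>
     (\<exists>K K'. compact K \<and> compact K' \<and> bilipschitz_homeomorphic (A - K) (B - K'))"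

definition hausdorff_converges :: "(nat \<Rightarrow> 'a::metric_space set) \<Rightarrow> 'a set \<Rightarrow> bool" where
  "hausdorff_converges S D \<longleftrightarrow> closed D \<and>
     (\<forall>e>0. eventually (\<lambda>j. (\<forall>x\<in>S j. \<exists>y\<in>D. dist x y < e) \<and> (\<forall>y\<in>D. \<exists>x\<in>S j. dist x y < e))
              sequentially)"

definition is_tangent_cone_at_infinity :: "'a::real_normed_vector set \<Rightarrow> 'a set \<Rightarrow> bool" where
  "is_tangent_cone_at_infinity X E \<longleftrightarrow>
     (\<exists>t D. (\<forall>j. t j > 0) \<and> filterlim t at_top sequentially \<and> D \<subseteq> sphere 0 1 \<and>
        hausdorff_converges (\<lambda>j. (\<lambda>x. (1 / t j) *\<^sub>R x) ` (X \<inter> {x. norm x = t j})) D \<and>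
        E = {s *\<^sub>R v | s v. v \<in> D \<and> s \<ge> 0})"

text \<open>The (unique, for unbounded semialgebraic X) tangent cone at infinity.\<close>
definition C_infinity :: "'a::real_normed_vector set \<Rightarrow> 'a set" where
  "C_infinity X = (THE E. is_tangent_cone_at_infinity X E)"

end

theory Submission
  imports Defs "HOL-Complex_Analysis.Great_Picard" "HOL-Computational_Algebra.Polynomial"
begin

text \<open>
  By Cohen-Hoermander quantifier elimination, a semialgebraic condition on a scale t that is
  quantified existentially over a point is eventually true or eventually false as t grows. Applied
  to ``\<open>A/t\<close> meets the ball of radius r around v on the unit sphere'', this makes the rescaled links
  of A converge, so the tangent cone at infinity exists, is unique, and consists of the limits of
  \<open>x\<^sub>j/t\<^sub>j\<close> with \<open>x\<^sub>j \<in> A\<close> and \<open>t\<^sub>j \<rightarrow> \<infinity>\<close>; each of its points is moreover approximated along every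
  sequence of scales. A bi-Lipschitz map f between A and B near infinity then gives equi-Lipschitz
  rescalings \<open>f (n w) / n\<close>, and a diagonal subsequence of them converges to a bi-Lipschitz map of
  the cones.
\<close>

section \<open>Matching the sign patterns of two real polynomials\<close>

text \<open>Semialgebraicity supplies one thing: a direction approached by the set along some
  sequence of scales is approached along every sequence. It is needed at both ends of the map. The
  rescaled maps are read at the scales n, so every point of the cone of \<open>A\<close> must be
  approximated at exactly these scales; and limits of their values along an uncontrolled subsequence
  must still land in the cone of \<open>B\<close>. Elimination manipulates no formulas. A quantifier
  is removed through a back-and-forth property: if two parameters give equal signs to finitely many
  polynomials, every value of the eliminated variable on one side has a partner on the other.
  Matching sign tables by increasing bijections of the line avoids enumerating roots and intervals.
  The price is that the bijection has to be corrected whenever a polynomial is added: it must send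
  the new zeros to zeros without disturbing the signs already matched.\<close>

lemma push_point_exists:
  fixes u v a b :: real
  assumes "u < a" "a < v" "u < b" "b < v"
  shows "\<exists>h. strict_mono h \<and> surj h \<and> h a = b \<and> (\<forall>x. x \<notin> {u<..<v} \<longrightarrow> h x = x)"
proof -
  \<comment> \<open>\<open>a\<close> and \<open>b\<close> stay explicit because exchanging them
    gives the inverse of this piecewise linear map, hence surjectivity.\<close>
  define h where "h a b x = (if x \<le> u \<or> x \<ge> v then x else if x \<le> a then u + (x - u) * ((b - u) / (a - u))
     else v - (v - x) * ((v - b) / (v - a)))" for a b x
  have low: "u < h a b x \<and> h a b x \<le> b" if "u < x" "x \<le> a" "u < a" "u < b" "a < v" "b < v" for a b x
  proof -
    have "(x - u) * ((b - u) / (a - u)) \<le> (a - u) * ((b - u) / (a - u))"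
      using that by (intro mult_right_mono) auto
    moreover have "0 < (x - u) * ((b - u) / (a - u))" using that by simp
    ultimately show ?thesis using that by (auto simp: h_def)
  qed
  have high: "b < h a b x \<and> h a b x < v" if "a < x" "x < v" "u < a" "u < b" "a < v" "b < v" for a b x
  proof -
    have "(v - x) * ((v - b) / (v - a)) < (v - a) * ((v - b) / (v - a))"
      using that by (intro mult_strict_right_mono) auto
    moreover have "0 < (v - x) * ((v - b) / (v - a))" using that by simp
    ultimately show ?thesis using that by (auto simp: h_def)
  qed
  have inv: "h a b (h b a x) = x" if "u < a" "u < b" "a < v" "b < v" for a b x
  proof -
    consider "x \<le> u \<or> x \<ge> v" | "u < x" "x \<le> b" | "b < x" "x < v" by linarith
    then show ?thesis
    proof cases
      case 1
      then show ?thesis by (auto simp: h_def)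
    next
      case 2
      with low[of x b a] that have *: "u < h b a x" "h b a x \<le> a" by auto
      have "h b a x = u + (x - u) * ((a - u) / (b - u))" using 2 that by (auto simp: h_def)
      then have "(h b a x - u) * ((b - u) / (a - u)) = x - u" using that by simp
      moreover have "h a b (h b a x) = u + (h b a x - u) * ((b - u) / (a - u))" using * that by (simp add: h_def)
      ultimately show ?thesis by simp
    next
      case 3
      with high[of b x a] that have *: "a < h b a x" "h b a x < v" by auto
      have "h b a x = v - (v - x) * ((v - a) / (v - b))" using 3 that by (auto simp: h_def)
      then have "(v - h b a x) * ((v - b) / (v - a)) = v - x" using that by simp
      moreover have "h a b (h b a x) = v - (v - h b a x) * ((v - b) / (v - a))" using * that by (simp add: h_def)
      ultimately show ?thesis by simp
    qed
  qed
  have "strict_mono (h a b)"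
  proof (rule strict_monoI)
    fix x y :: real assume xy: "x < y"
    consider "x \<le> u" | "v \<le> y" | "u < x" "y \<le> a" | "a < x" "y < v" | "u < x" "x \<le> a" "a < y" "y < v"
      using xy by linarith
    then show "h a b x < h a b y"
    proof cases
      case 1
      then have "h a b x = x" by (simp add: h_def)
      moreover consider "y \<le> u \<or> y \<ge> v" | "u < y" "y \<le> a" | "a < y" "y < v" by linarith
      then have "h a b y = y \<or> h a b y > u"
        using low[of y a b] high[of a y b] assms by cases (auto simp: h_def)
      ultimately show ?thesis using xy 1 by linarith
    next
      case 2
      then have "h a b y = y" by (simp add: h_def)
      moreover consider "x \<le> u \<or> x \<ge> v" | "u < x" "x \<le> a" | "a < x" "x < v" by linarith
      then have "h a b x = x \<or> h a b x < v"
        using low[of x a b] high[of a x b] assms by cases (auto simp: h_def)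
      ultimately show ?thesis using xy 2 by linarith
    next
      case 3
      have "(x - u) * ((b - u) / (a - u)) < (y - u) * ((b - u) / (a - u))"
        using assms xy by (intro mult_strict_right_mono) auto
      then show ?thesis using 3 xy assms by (simp add: h_def)
    next
      case 4
      have "(v - y) * ((v - b) / (v - a)) < (v - x) * ((v - b) / (v - a))"
        using assms xy by (intro mult_strict_right_mono) auto
      then show ?thesis using 4 xy assms by (simp add: h_def)
    next
      case 5
      then show ?thesis using low[of x a b] high[of a y b] assms by linarith
    qed
  qed
  moreover have "surj (h a b)" using inv assms by (metis surjI)
  moreover have "h a b a = b" using assms by (simp add: h_def)
  moreover have "h a b x = x" if "x \<notin> {u<..<v}" for x using that by (auto simp: h_def)
  ultimately show ?thesis by blast
qed

lemma poly_zero_between_sgn_neq: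
  fixes r :: "real poly"
  assumes "sgn (poly r a) \<noteq> sgn (poly r b)"
  shows "\<exists>x\<in>closed_segment a b. poly r x = 0"
proof -
  have *: "\<exists>x\<in>{a..b}. poly r x = 0" if "sgn (poly r a) \<noteq> sgn (poly r b)" "a \<le> b" for a b
  proof (cases "poly r a = 0 \<or> poly r b = 0 \<or> a = b")
    case True
    then show ?thesis using that by auto
  next
    case False
    then have "poly r a * poly r b < 0" "a < b"
      using that by (auto simp: sgn_if mult_less_0_iff split: if_splits)
    then show ?thesis using poly_IVT[of a b r] by (auto intro: less_imp_le)
  qed
  show ?thesis
    using *[of a b] *[of b a] assms by (cases "a \<le> b") (auto simp: closed_segment_eq_real_ivl)
qed

text \<open>A zero of \<open>r\<close> is the common value of both maps at some \<open>z\<close> in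
  \<open>Z\<close>. If \<open>y\<close> differs from \<open>z\<close>, monotonicity puts
  \<open>\<phi> y\<close> and \<open>\<psi> y\<close> on the same side of that zero, so no sign
  change can separate them. A matching may thus be altered between the points of \<open>Z\<close>
  without losing signs.\<close>

lemma sgn_poly_cong_if_agree_on_zeros:
  fixes r :: "real poly" and \<phi> \<psi> :: "real \<Rightarrow> real"
  assumes "strict_mono \<phi>" "strict_mono \<psi>" "\<And>z. z \<in> Z \<Longrightarrow> \<psi> z = \<phi> z"
    and "\<And>x. poly r x = 0 \<Longrightarrow> x \<in> \<phi> ` Z"
  shows "sgn (poly r (\<psi> y)) = sgn (poly r (\<phi> y))"
proof (rule ccontr)
  assume neq: "\<not> ?thesis"
  then obtain x where x: "x \<in> closed_segment (\<psi> y) (\<phi> y)" "poly r x = 0"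
    using poly_zero_between_sgn_neq by blast
  then obtain z where z: "z \<in> Z" "x = \<phi> z" using assms(4) by blast
  with assms(3) have "x = \<psi> z" by simp
  consider "z < y" | "z = y" | "y < z" by linarith
  then show False
  proof cases
    case 1
    then have "x < \<phi> y" "x < \<psi> y" using z \<open>x = \<psi> z\<close> assms(1,2) by (auto dest: strict_monoD)
    then show ?thesis using x by (auto simp: closed_segment_eq_real_ivl split: if_splits)
  next
    case 2
    then have "\<psi> y = \<phi> y" using z(1) assms(3) by blast
    then show ?thesis using neq by simp
  next
    case 3
    then have "x > \<phi> y" "x > \<psi> y" using z \<open>x = \<psi> z\<close> assms(1,2) by (auto dest: strict_monoD)
    then show ?thesis using x by (auto simp: closed_segment_eq_real_ivl split: if_splits)
  qed
qed

text \<open>A positive derivative alone would allow a bounded negative function; for a polynomial it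
  forces a positive leading coefficient, because that of the derivative is \<open>degree q\<close>
  times that of \<open>q\<close>. This settles the unbounded component.\<close>

lemma poly_increasing_ray_imp_pos:
  fixes q :: "real poly"
  assumes "degree q > 0" and "\<And>x. x \<ge> a \<Longrightarrow> poly (pderiv q) x > 0"
  shows "\<exists>d\<ge>a. poly q d > 0"
proof -
  have nz: "lead_coeff q \<noteq> 0" using assms(1) by auto
  have lc: "lead_coeff (pderiv q) = of_nat (degree q) * lead_coeff q"
    using assms(1) by (simp add: degree_pderiv coeff_pderiv)
  have "lead_coeff q > 0"
  proof (rule ccontr)
    assume "\<not> lead_coeff q > 0"
    with nz have "lead_coeff q < 0" by linarith
    then have "lead_coeff (pderiv q) < 0" using assms(1) by (simp only: lc mult_less_0_iff) simp
    then have "0 < lead_coeff (- pderiv q)" by (simp add: lead_coeff_minus)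
    then obtain n where n: "\<And>x. x \<ge> n \<Longrightarrow> poly (- pderiv q) x \<ge> lead_coeff (- pderiv q)"
      using poly_pinfty_gt_lc by blast
    have "poly (- pderiv q) (max n a) > 0" using n[of "max n a"] \<open>0 < lead_coeff (- pderiv q)\<close> by simp
    then show False using assms(2)[of "max n a"] by simp
  qed
  then obtain n where n: "\<And>x. x \<ge> n \<Longrightarrow> poly q x \<ge> lead_coeff q"
    using poly_pinfty_gt_lc by blast
  have "poly q (max n a) > 0" using n[of "max n a"] \<open>0 < lead_coeff q\<close> by simp
  then show ?thesis by (intro exI[of _ "max n a"]) auto
qed

text \<open>\<phi> matches the sign patterns of the derivatives of p and q, and \<open>Z\<close> contains the
  critical points of p, so p and q are monotone in the same direction on corresponding components
  of the complements of \<open>Z\<close> and \<open>\<phi> ` Z\<close>.\<close>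

locale sign_match =
  fixes Z :: "real set" and \<phi> :: "real \<Rightarrow> real" and p q :: "real poly"
  assumes fin: "finite Z" and mono: "strict_mono \<phi>" and surj: "surj \<phi>"
    and degp: "degree p > 0" and degq: "degree q > 0"
    and crit: "\<And>y. poly (pderiv p) y = 0 \<Longrightarrow> y \<in> Z"
    and deriv: "\<And>y. sgn (poly (pderiv p) y) = sgn (poly (pderiv q) (\<phi> y))"
    and val: "\<And>z. z \<in> Z \<Longrightarrow> sgn (poly p z) = sgn (poly q (\<phi> z))"
begin

lemma less_iff: "\<phi> x < \<phi> y \<longleftrightarrow> x < y"
  using mono by (simp add: strict_mono_less)

text \<open>\<open>p\<close> increases from \<open>y\<close> to the next point \<open>r\<close> of
  \<open>Z\<close>, so \<open>p\<close> is positive at \<open>r\<close> and \<open>q\<close> at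
  \<open>\<phi> r\<close>; by continuity \<open>q\<close> is positive just left of
  \<open>\<phi> r\<close>, still in the component of \<open>\<phi> y\<close>. If there is no such
  \<open>r\<close>, the derivative of \<open>q\<close> is positive on a whole ray.\<close>

lemma exists_pos_right:
  assumes "y \<notin> Z" "poly p y \<ge> 0" "poly (pderiv p) y > 0"
  shows "\<exists>d. closed_segment (\<phi> y) d \<inter> \<phi> ` Z = {} \<and> poly q d > 0"
proof -
  have der: "poly (pderiv p) x > 0" if "y \<le> x" "{y..x} \<inter> Z = {}" for x
  proof (rule ccontr)
    assume "\<not> poly (pderiv p) x > 0"
    then have "sgn (poly (pderiv p) y) \<noteq> sgn (poly (pderiv p) x)"
      using assms(3) by (auto simp: sgn_if)
    then obtain w where "w \<in> closed_segment y x" "poly (pderiv p) w = 0"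
      using poly_zero_between_sgn_neq by blast
    then show False using that crit by (auto simp: closed_segment_eq_real_ivl)
  qed
  show ?thesis
  proof (cases "\<exists>z\<in>Z. z > y")
    case False
    have "poly (pderiv q) x > 0" if "x \<ge> \<phi> y" for x
    proof -
      obtain w where w: "x = \<phi> w" using surj by auto
      then have "y \<le> w" using that mono by (simp add: strict_mono_less_eq)
      moreover have "{y..w} \<inter> Z = {}" using False assms(1) by force
      ultimately have "poly (pderiv p) w > 0" using der by blast
      then show ?thesis using deriv[of w] w by (auto simp: sgn_if split: if_splits)
    qed
    then obtain d where "d \<ge> \<phi> y" "poly q d > 0"
      using poly_increasing_ray_imp_pos[OF degq] by blast
    moreover have "{\<phi> y..d} \<inter> \<phi> ` Z = {}"
      using False assms(1) mono by (force simp: strict_mono_less_eq)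
    ultimately show ?thesis by (auto simp: closed_segment_eq_real_ivl)
  next
    case True
    define r where "r = Min {z\<in>Z. z > y}"
    have "r \<in> {z\<in>Z. z > y}" unfolding r_def using True fin by (intro Min_in) auto
    then have r: "r \<in> Z" "r > y" by auto
    have rmin: "r \<le> z" if "z \<in> Z" "z > y" for z using that fin by (auto simp: r_def)
    have "poly p y < poly p r"
    proof (rule DERIV_pos_imp_increasing_open[OF r(2)])
      fix x assume x: "y < x" "x < r"
      have "{y..x} \<inter> Z = {}" using rmin x assms(1) by force
      then have "poly (pderiv p) x > 0" using der x by simp
      then show "\<exists>y. DERIV (poly p) x :> y \<and> y > 0" using poly_DERIV by blast
    qed (auto intro: continuous_intros)
    with assms(2) val[OF r(1)] have "poly q (\<phi> r) > 0" by (auto simp: sgn_if split: if_splits)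
    moreover have "(poly q \<longlongrightarrow> poly q (\<phi> r)) (at_left (\<phi> r))"
      by (intro tendsto_intros)
    ultimately have "eventually (\<lambda>d. poly q d > 0) (at_left (\<phi> r))"
      using order_tendstoD(1) by blast
    moreover have "eventually (\<lambda>d. d \<in> {\<phi> y<..<\<phi> r}) (at_left (\<phi> r))"
      using r(2) by (intro eventually_at_left_real) (simp add: less_iff)
    ultimately have "eventually (\<lambda>d. poly q d > 0 \<and> d \<in> {\<phi> y<..<\<phi> r}) (at_left (\<phi> r))"
      by (rule eventually_conj)
    then obtain d where d: "poly q d > 0" "\<phi> y < d" "d < \<phi> r"
      using eventually_happens'[OF trivial_limit_at_left_real] by fastforce
    have "\<phi> z \<notin> {\<phi> y..d}" if "z \<in> Z" for z
    proof
      assume "\<phi> z \<in> {\<phi> y..d}"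
      then have "y \<le> z" "\<phi> z < \<phi> r" using d mono by (auto simp: strict_mono_less_eq)
      then have "y < z" "z < r" using assms(1) that less_iff by (auto simp: order.strict_iff_order)
      with rmin that show False by force
    qed
    with d show ?thesis by (intro exI[of _ d]) (auto simp: closed_segment_eq_real_ivl)
  qed
qed

text \<open>Conjugation by x \<mapsto> -x makes a decreasing \<open>p\<close> increasing, so a
  search to the left reduces to \<open>exists_pos_right\<close>.\<close>

lemma reflect: "sign_match (uminus ` Z) (\<lambda>y. - \<phi> (- y)) (p \<circ>\<^sub>p [:0, -1:]) (q \<circ>\<^sub>p [:0, -1:])"
proof
  show "surj (\<lambda>y. - \<phi> (- y))"
    using surj by (metis (no_types, lifting) minus_equation_iff surj_def)
  show "strict_mono (\<lambda>y. - \<phi> (- y))" by (rule strict_monoI) (simp add: less_iff)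
  fix y
  show "poly (pderiv (p \<circ>\<^sub>p [:0, -1:])) y = 0 \<Longrightarrow> y \<in> uminus ` Z"
    using crit[of "-y"] by (auto simp: pderiv_pcompose poly_pcompose pderiv_pCons intro!: image_eqI[of _ _ "-y"])
  show "sgn (poly (pderiv (p \<circ>\<^sub>p [:0, -1:])) y) = sgn (poly (pderiv (q \<circ>\<^sub>p [:0, -1:])) (- \<phi> (- y)))"
    using deriv[of "-y"] by (simp add: pderiv_pcompose poly_pcompose pderiv_pCons sgn_mult)
qed (use fin degp degq val in \<open>auto simp: poly_pcompose degree_pcompose\<close>)

lemma negate: "sign_match Z \<phi> (- p) (- q)"
  by standard (use fin mono surj degp degq crit deriv val in \<open>auto simp: pderiv_minus sgn_minus\<close>)

lemma exists_pos:
  assumes "y \<notin> Z" "poly p y \<ge> 0"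
  shows "\<exists>d. closed_segment (\<phi> y) d \<inter> \<phi> ` Z = {} \<and> poly q d > 0"
proof (cases "poly (pderiv p) y > 0")
  case True
  then show ?thesis using exists_pos_right assms by blast
next
  case False
  then have "poly (pderiv p) y < 0" using assms(1) crit[of y] by force
  interpret R: sign_match "uminus ` Z" "\<lambda>y. - \<phi> (- y)" "p \<circ>\<^sub>p [:0, -1:]" "q \<circ>\<^sub>p [:0, -1:]"
    by (rule reflect)
  have "- y \<notin> uminus ` Z" using assms(1) by auto
  then obtain d where d: "closed_segment (- \<phi> y) d \<inter> (\<lambda>y. - \<phi> (- y)) ` uminus ` Z = {}"
      "poly (q \<circ>\<^sub>p [:0, -1:]) d > 0"
    using R.exists_pos_right[of "-y"] assms \<open>poly (pderiv p) y < 0\<close>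
    by (auto simp: pderiv_pcompose poly_pcompose pderiv_pCons)
  have "\<phi> z \<notin> closed_segment (\<phi> y) (- d)" if "z \<in> Z" for z
  proof
    assume "\<phi> z \<in> closed_segment (\<phi> y) (- d)"
    then have "- \<phi> z \<in> closed_segment (- \<phi> y) d"
      by (auto simp: closed_segment_eq_real_ivl split: if_splits)
    moreover have "- \<phi> z \<in> (\<lambda>y. - \<phi> (- y)) ` uminus ` Z" using that by (auto simp: image_iff)
    ultimately show False using d(1) by blast
  qed
  then show ?thesis using d(2) by (intro exI[of _ "- d"]) (auto simp: poly_pcompose)
qed

lemma exists_neg:
  assumes "y \<notin> Z" "poly p y \<le> 0"
  shows "\<exists>d. closed_segment (\<phi> y) d \<inter> \<phi> ` Z = {} \<and> poly q d < 0"
  using sign_match.exists_pos[OF negate, of y] assms by simp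

text \<open>The component of \<open>\<phi> y\<close> contains points where \<open>q\<close> is
  positive and points where it is negative, since both weak inequalities hold for \<open>p\<close>
  at \<open>y\<close>; the intermediate value theorem does the rest.\<close>

lemma exists_zero:
  assumes "y \<notin> Z" "poly p y = 0"
  shows "\<exists>d. closed_segment (\<phi> y) d \<inter> \<phi> ` Z = {} \<and> poly q d = 0"
proof -
  obtain a b where a: "closed_segment (\<phi> y) a \<inter> \<phi> ` Z = {}" "poly q a > 0"
    and b: "closed_segment (\<phi> y) b \<inter> \<phi> ` Z = {}" "poly q b < 0"
    using exists_pos[of y] exists_neg[of y] assms by auto
  then obtain d where d: "d \<in> closed_segment a b" "poly q d = 0"
    using poly_zero_between_sgn_neq[of q a b] by auto
  have "closed_segment (\<phi> y) d \<subseteq> closed_segment (\<phi> y) a \<union> closed_segment (\<phi> y) b"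
    using d(1) by (auto simp: closed_segment_eq_real_ivl split: if_splits)
  with a b d show ?thesis by blast
qed

lemma cong:
  assumes "strict_mono \<psi>" "surj \<psi>" "\<And>z. z \<in> Z \<Longrightarrow> \<psi> z = \<phi> z"
  shows "sign_match Z \<psi> p q"
proof
  fix y
  have "x \<in> \<phi> ` Z" if "poly (pderiv q) x = 0" for x
    using surj deriv that crit by (metis imageI sgn_0_0 surj_def)
  then have "sgn (poly (pderiv q) (\<psi> y)) = sgn (poly (pderiv q) (\<phi> y))"
    using sgn_poly_cong_if_agree_on_zeros[OF mono assms(1,3)] by blast
  then show "sgn (poly (pderiv p) y) = sgn (poly (pderiv q) (\<psi> y))" using deriv by simp
qed (use fin degp degq val crit assms in auto)

lemma inverse: "sign_match (\<phi> ` Z) (inv \<phi>) q p"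
proof
  have inj: "inj \<phi>" using mono by (simp add: strict_mono_imp_inj_on)
  show "strict_mono (inv \<phi>)" by (rule strict_monoI) (metis less_iff surj surj_f_inv_f)
  show "surj (inv \<phi>)" using inj by (rule inj_imp_surj_inv)
  fix y
  show "poly (pderiv q) y = 0 \<Longrightarrow> y \<in> \<phi> ` Z"
    using surj deriv crit by (metis imageI sgn_0_0 surj_def)
  show "sgn (poly (pderiv q) y) = sgn (poly (pderiv p) (inv \<phi> y))"
    using deriv[of "inv \<phi> y"] surj by (simp add: surj_f_inv_f)
  show "y \<in> \<phi> ` Z \<Longrightarrow> sgn (poly q y) = sgn (poly p (inv \<phi> y))"
    using val inj by auto
qed (use fin degp degq in auto)

lemma critical_between_zeros:
  assumes "poly p a = 0" "poly p b = 0" "a \<noteq> b"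
  shows "\<exists>z\<in>Z. z \<in> open_segment a b"
proof -
  have *: "\<exists>z\<in>Z. a < z \<and> z < b" if "a < b" "poly p a = 0" "poly p b = 0" for a b
    using poly_MVT[OF that(1), of p] that crit by auto
  show ?thesis
    using *[of a b] *[of b a] assms by (cases "a < b") (force simp: open_segment_eq_real_ivl)+
qed

text \<open>Zeros of \<open>p\<close> are treated one at a time, by composing with a map that moves
  \<open>\<psi> c\<close> to a zero \<open>d\<close> of \<open>q\<close> and is the identity outside
  a small interval. By Rolle a point of \<open>Z\<close> lies between any two zeros of
  \<open>p\<close>, so this interval contains no image of a zero already treated.\<close>

lemma map_zeros:
  assumes "finite N" "\<And>c. c \<in> N \<Longrightarrow> poly p c = 0"
  shows "\<exists>\<psi>. strict_mono \<psi> \<and> surj \<psi> \<and> (\<forall>z\<in>Z. \<psi> z = \<phi> z) \<and> (\<forall>c\<in>N. poly q (\<psi> c) = 0)"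
  using assms
proof (induction N rule: finite_induct)
  case empty
  then show ?case using mono surj by auto
next
  case (insert c N)
  then obtain \<psi> where \<psi>: "strict_mono \<psi>" "surj \<psi>" "\<And>z. z \<in> Z \<Longrightarrow> \<psi> z = \<phi> z"
    and N: "\<And>n. n \<in> N \<Longrightarrow> poly q (\<psi> n) = 0" by auto
  interpret P: sign_match Z \<psi> p q using cong \<psi> by blast
  show ?case
  proof (cases "c \<in> Z")
    case True
    then have "poly q (\<psi> c) = 0" using P.val[OF True] insert.prems[of c] by (simp add: sgn_0_0)
    then show ?thesis using \<psi> N by auto
  next
    case False
    then obtain d where d: "closed_segment (\<psi> c) d \<inter> \<psi> ` Z = {}" "poly q d = 0"
      using P.exists_zero[of c] insert.prems[of c] by auto
    have "\<exists>e>0. \<forall>w\<in>\<psi> ` Z. \<forall>x\<in>closed_segment (\<psi> c) d. e \<le> dist x w"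
      using separate_compact_closed[of "closed_segment (\<psi> c) d" "\<psi> ` Z"] d(1) fin
      by (auto simp: finite_imp_closed)
    then obtain e where e: "e > 0" "\<And>w x. w \<in> \<psi> ` Z \<Longrightarrow> x \<in> closed_segment (\<psi> c) d \<Longrightarrow> e \<le> dist x w"
      by blast
    \<comment> \<open>Widening the segment by \<open>e\<close>, a lower bound for its distance to
      the images of \<open>Z\<close>, puts both end points strictly inside while the open interval
      still misses those images.\<close>
    define u where "u = min (\<psi> c) d - e"
    define v where "v = max (\<psi> c) d + e"
    have uv: "w \<notin> {u<..<v}" if "w \<in> \<psi> ` Z" for w
    proof
      assume "w \<in> {u<..<v}"
      moreover have "w \<notin> closed_segment (\<psi> c) d" using that d(1) by blast
      moreover have "e \<le> dist (min (\<psi> c) d) w" "e \<le> dist (max (\<psi> c) d) w"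
        using e(2)[OF that] by (auto simp: min_def max_def)
      ultimately show False
        by (auto simp: u_def v_def dist_real_def closed_segment_eq_real_ivl split: if_splits)
    qed
    have in_uv: "u < \<psi> c" "\<psi> c < v" "u < d" "d < v" using e(1) by (auto simp: u_def v_def)
    obtain h where h: "strict_mono h" "surj h" "h (\<psi> c) = d" "\<And>x. x \<notin> {u<..<v} \<Longrightarrow> h x = x"
      using push_point_exists[OF in_uv] by blast
    have "\<psi> n \<notin> {u<..<v}" if "n \<in> N" for n
    proof
      assume n: "\<psi> n \<in> {u<..<v}"
      have "n \<noteq> c" "poly p n = 0" "poly p c = 0" using that insert by auto
      then obtain z where z: "z \<in> Z" "z \<in> open_segment n c" using critical_between_zeros by blast
      then have "\<psi> z \<in> {u<..<v}"
        using n in_uv(1,2) P.less_iff[of n z] P.less_iff[of z c] P.less_iff[of c z] P.less_iff[of z n]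
        by (auto simp: open_segment_eq_real_ivl split: if_splits)
      with uv z show False by blast
    qed
    then have "\<forall>n\<in>insert c N. poly q ((h \<circ> \<psi>) n) = 0" using h N d(2) by auto
    moreover have "\<forall>z\<in>Z. (h \<circ> \<psi>) z = \<phi> z" using h(4) uv \<psi>(3) by auto
    moreover have "strict_mono (h \<circ> \<psi>)" using h(1) \<psi>(1) by (simp add: strict_mono_o)
    moreover have "surj (h \<circ> \<psi>)" using h(2) \<psi>(2) by (rule comp_surj[rotated])
    ultimately show ?thesis by blast
  qed
qed

text \<open>If \<open>q\<close> were negative at \<open>\<phi> y\<close>, it would vanish at some
  \<open>\<phi> x\<close> in the same component, where it also takes positive values; then
  \<open>p\<close> vanishes at \<open>x\<close>. By the mean value theorem the increments of
  \<open>p\<close> from \<open>x\<close> to \<open>y\<close> and of \<open>q\<close> between the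
  images have the same sign, as the derivatives keep matching signs there. One is positive and the
  other negative, a contradiction.\<close>

lemma pos_if_zeros_match:
  assumes zeros: "\<And>c. poly p c = 0 \<Longrightarrow> poly q (\<phi> c) = 0" and pos: "poly p y > 0"
  shows "poly q (\<phi> y) > 0"
proof (cases "y \<in> Z")
  case True
  then show ?thesis using val[OF True] pos by (auto simp: sgn_if split: if_splits)
next
  case False
  interpret I: sign_match "\<phi> ` Z" "inv \<phi>" q p by (rule inverse)
  have inj: "inj \<phi>" using mono by (simp add: strict_mono_imp_inj_on)
  \<comment> \<open>The inverse match yields a zero \<open>c\<close> of \<open>p\<close> in the
    component of \<open>x\<close>. If \<open>c\<close> differed from \<open>x\<close>, Rolle applied
    to \<open>q\<close> would put the image of a point of \<open>Z\<close> between their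
    images.\<close>
  have zeros': "poly p x = 0" if x: "poly q (\<phi> x) = 0" for x
  proof (cases "x \<in> Z")
    case True
    then show ?thesis using val[OF True] x by (simp add: sgn_0_0)
  next
    case False
    then have "\<phi> x \<notin> \<phi> ` Z" using inj by (auto simp: inj_def)
    then obtain c where c: "closed_segment x c \<inter> Z = {}" "poly p c = 0"
      using I.exists_zero[of "\<phi> x"] x inj by (auto simp: image_image)
    have "c = x"
    proof (rule ccontr)
      assume "c \<noteq> x"
      then have "\<phi> c \<noteq> \<phi> x" using inj by (auto simp: inj_def)
      then obtain z where z: "z \<in> Z" "\<phi> z \<in> open_segment (\<phi> x) (\<phi> c)"
        using I.critical_between_zeros[of "\<phi> x" "\<phi> c"] x zeros[OF c(2)] by auto
      then have "z \<in> closed_segment x c"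
        using less_iff by (auto simp: open_segment_eq_real_ivl closed_segment_eq_real_ivl less_imp_le split: if_splits)
      with z c show False by blast
    qed
    with c show ?thesis by simp
  qed
  obtain d where d: "closed_segment (\<phi> y) d \<inter> \<phi> ` Z = {}" "poly q d > 0"
    using exists_pos[OF False] pos by auto
  show ?thesis
  proof (rule ccontr)
    assume neg: "\<not> poly q (\<phi> y) > 0"
    have "poly q (\<phi> y) \<noteq> 0" using zeros' pos by force
    with neg have neg: "poly q (\<phi> y) < 0" by simp
    obtain x' where x': "x' \<in> closed_segment (\<phi> y) d" "poly q x' = 0"
      using poly_zero_between_sgn_neq[of q "\<phi> y" d] neg d by auto
    obtain x where x: "x' = \<phi> x" using surj by auto
    have px: "poly p x = 0" using zeros' x x' by simp
    with pos have "x \<noteq> y" by auto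
    have free: "closed_segment x y \<inter> Z = {}"
    proof -
      have "closed_segment (\<phi> y) (\<phi> x) \<subseteq> closed_segment (\<phi> y) d" using x x' by (simp add: subset_closed_segment)
      then have "closed_segment (\<phi> y) (\<phi> x) \<inter> \<phi> ` Z = {}" using d by blast
      moreover have "\<phi> z \<in> closed_segment (\<phi> y) (\<phi> x)" if "z \<in> closed_segment x y" for z
        using that mono by (auto simp: closed_segment_eq_real_ivl strict_mono_less_eq split: if_splits)
      ultimately show ?thesis by blast
    qed
    have const: "sgn (poly (pderiv p) a) = sgn (poly (pderiv p) b)"
      if "a \<in> closed_segment x y" "b \<in> closed_segment x y" for a b
    proof (rule ccontr)
      assume "\<not> ?thesis"
      then obtain c where c: "c \<in> closed_segment a b" "poly (pderiv p) c = 0"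
        using poly_zero_between_sgn_neq by blast
      then have "c \<in> closed_segment x y" using that by (meson subsetD subset_closed_segment)
      with c crit free show False by blast
    qed
    have inc: "\<exists>\<xi>. \<xi> \<in> closed_segment a b \<and> poly r b - poly r a = (b - a) * poly (pderiv r) \<xi>"
      if ab: "a \<noteq> b" for a b :: real and r
    proof (cases "a < b")
      case True
      then obtain \<xi> where "a < \<xi>" "\<xi> < b" "poly r b - poly r a = (b - a) * poly (pderiv r) \<xi>"
        using poly_MVT[of a b r] by auto
      then show ?thesis by (intro exI[of _ \<xi>]) (auto simp: closed_segment_eq_real_ivl)
    next
      case False
      then obtain \<xi> where "b < \<xi>" "\<xi> < a" "poly r a - poly r b = (a - b) * poly (pderiv r) \<xi>"
        using poly_MVT[of b a r] ab by auto
      then show ?thesis using ab by (intro exI[of _ \<xi>]) (auto simp: closed_segment_eq_real_ivl algebra_simps)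
    qed
    obtain \<xi> where \<xi>: "\<xi> \<in> closed_segment x y" "poly p y - poly p x = (y - x) * poly (pderiv p) \<xi>"
      using inc[OF \<open>x \<noteq> y\<close>] by blast
    have "\<phi> x \<noteq> \<phi> y" using inj \<open>x \<noteq> y\<close> by (auto simp: inj_def)
    then obtain \<eta>' where \<eta>': "\<eta>' \<in> closed_segment (\<phi> x) (\<phi> y)"
        "poly q (\<phi> y) - poly q (\<phi> x) = (\<phi> y - \<phi> x) * poly (pderiv q) \<eta>'"
      using inc by blast
    obtain \<eta> where \<eta>: "\<eta>' = \<phi> \<eta>" using surj by auto
    have "\<eta> \<in> closed_segment x y"
      using \<eta> \<eta>'(1) mono by (auto simp: closed_segment_eq_real_ivl strict_mono_less_eq split: if_splits)
    then have "sgn (poly (pderiv p) \<xi>) = sgn (poly (pderiv q) \<eta>')" using const[OF \<xi>(1)] deriv[of \<eta>] \<eta> by metis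
    moreover have "sgn (y - x) = sgn (\<phi> y - \<phi> x)" using less_iff[of x y] less_iff[of y x] \<open>x \<noteq> y\<close> by (auto simp: sgn_if)
    ultimately have "sgn (poly p y - poly p x) = sgn (poly q (\<phi> y) - poly q (\<phi> x))"
      using \<xi>(2) \<eta>'(2) by (simp add: sgn_mult)
    then show False using pos neg px x x' by simp
  qed
qed

theorem transfer:
  "\<exists>\<psi>. strict_mono \<psi> \<and> surj \<psi> \<and> (\<forall>z\<in>Z. \<psi> z = \<phi> z) \<and> (\<forall>y. sgn (poly p y) = sgn (poly q (\<psi> y)))"
proof -
  have "p \<noteq> 0" using degp by auto
  then have "\<exists>\<psi>. strict_mono \<psi> \<and> surj \<psi> \<and> (\<forall>z\<in>Z. \<psi> z = \<phi> z) \<and> (\<forall>c\<in>{c. poly p c = 0}. poly q (\<psi> c) = 0)"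
    by (intro map_zeros poly_roots_finite) auto
  then obtain \<psi> where \<psi>: "strict_mono \<psi>" "surj \<psi>" "\<And>z. z \<in> Z \<Longrightarrow> \<psi> z = \<phi> z"
    and zeros: "\<And>c. poly p c = 0 \<Longrightarrow> poly q (\<psi> c) = 0"
    by blast
  interpret P: sign_match Z \<psi> p q using cong \<psi> by blast
  have "sgn (poly p y) = sgn (poly q (\<psi> y))" for y
  proof -
    consider "poly p y = 0" | "poly p y > 0" | "poly p y < 0" by linarith
    then show ?thesis
    proof cases
      case 1
      then show ?thesis using zeros by simp
    next
      case 2
      then show ?thesis using P.pos_if_zeros_match zeros by simp
    next
      case 3
      then show ?thesis using sign_match.pos_if_zeros_match[OF P.negate, of y] zeros by simp
    qed
  qed
  with \<psi> show ?thesis by blast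
qed

end

section \<open>Quantifier elimination\<close>

text \<open>Polynomials are functions of an assignment of all variables, and \<open>S\<close>
  records which may occur. Eliminating a variable then shrinks \<open>S\<close> and leaves the type
  unchanged.\<close>

inductive_set poly_in :: "'v set \<Rightarrow> (('v \<Rightarrow> real) \<Rightarrow> real) set" for S :: "'v set" where
  const: "(\<lambda>e. c) \<in> poly_in S"
| var: "v \<in> S \<Longrightarrow> (\<lambda>e. e v) \<in> poly_in S"
| add: "f \<in> poly_in S \<Longrightarrow> g \<in> poly_in S \<Longrightarrow> (\<lambda>e. f e + g e) \<in> poly_in S"
| mult: "f \<in> poly_in S \<Longrightarrow> g \<in> poly_in S \<Longrightarrow> (\<lambda>e. f e * g e) \<in> poly_in S"

lemma poly_in_diff: "f \<in> poly_in S \<Longrightarrow> g \<in> poly_in S \<Longrightarrow> (\<lambda>e. f e - g e) \<in> poly_in S"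
  using poly_in.add[of f S "\<lambda>e. (-1) * g e"] poly_in.mult[OF poly_in.const[of "-1" S], of g] by simp

lemma poly_in_sum:
  "(\<And>i. i \<in> I \<Longrightarrow> f i \<in> poly_in S) \<Longrightarrow> (\<lambda>e. \<Sum>i\<in>I. f i e) \<in> poly_in S"
  by (induction I rule: infinite_finite_induct) (auto intro: poly_in.intros)

text \<open>The degree of \<open>f e\<close> may drop where leading coefficients vanish. The bound
  uniform in \<open>e\<close> ensures that finitely many coefficient functions describe the
  family.\<close>

definition coeffs_in :: "'v set \<Rightarrow> (('v \<Rightarrow> real) \<Rightarrow> real poly) set" where
  "coeffs_in S = {f. (\<forall>i. (\<lambda>e. coeff (f e) i) \<in> poly_in S) \<and> (\<exists>d. \<forall>e. degree (f e) \<le> d)}"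

lemma coeffs_in_coeff: "f \<in> coeffs_in S \<Longrightarrow> (\<lambda>e. coeff (f e) i) \<in> poly_in S"
  by (auto simp: coeffs_in_def)

lemma coeffs_in_const: "(\<lambda>e. p) \<in> coeffs_in S"
  by (auto simp: coeffs_in_def intro: poly_in.const)

lemma coeffs_in_pCons: "a \<in> poly_in S \<Longrightarrow> (\<lambda>e. [:a e:]) \<in> coeffs_in S"
  unfolding coeffs_in_def
proof (intro CollectI conjI allI)
  show "(\<lambda>e. coeff [:a e:] i) \<in> poly_in S" if "a \<in> poly_in S" for i
    using that poly_in.const[of 0] by (cases i) auto
qed auto

lemma coeffs_in_add:
  assumes "f \<in> coeffs_in S" "g \<in> coeffs_in S"
  shows "(\<lambda>e. f e + g e) \<in> coeffs_in S"
proof -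
  obtain d d' where "\<forall>e. degree (f e) \<le> d" "\<forall>e. degree (g e) \<le> d'"
    using assms by (auto simp: coeffs_in_def)
  then have "\<forall>e. degree (f e + g e) \<le> max d d'" by (meson degree_add_le max.coboundedI1 max.coboundedI2)
  then show ?thesis using assms by (auto simp: coeffs_in_def intro: poly_in.add)
qed

lemma coeffs_in_mult:
  assumes "f \<in> coeffs_in S" "g \<in> coeffs_in S"
  shows "(\<lambda>e. f e * g e) \<in> coeffs_in S"
proof -
  obtain d d' where d: "\<And>e. degree (f e) \<le> d" "\<And>e. degree (g e) \<le> d'"
    using assms by (auto simp: coeffs_in_def)
  have "degree (f e * g e) \<le> d + d'" for e
    using degree_mult_le[of "f e" "g e"] d(1)[of e] d(2)[of e] by linarith
  moreover have "(\<lambda>e. coeff (f e * g e) i) \<in> poly_in S" for i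
    unfolding coeff_mult by (intro poly_in_sum poly_in.mult coeffs_in_coeff assms)
  ultimately show ?thesis by (auto simp: coeffs_in_def)
qed

lemma coeffs_in_smult:
  assumes "a \<in> poly_in S" "f \<in> coeffs_in S"
  shows "(\<lambda>e. smult (a e) (f e)) \<in> coeffs_in S"
  using coeffs_in_mult[OF coeffs_in_pCons[OF assms(1)] assms(2)] by simp

lemma coeffs_in_diff:
  assumes "f \<in> coeffs_in S" "g \<in> coeffs_in S"
  shows "(\<lambda>e. f e - g e) \<in> coeffs_in S"
  using coeffs_in_add[OF assms(1) coeffs_in_smult[OF poly_in.const[of "-1"] assms(2)]] by simp

lemma coeffs_in_pderiv:
  assumes "f \<in> coeffs_in S"
  shows "(\<lambda>e. pderiv (f e)) \<in> coeffs_in S"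
proof -
  obtain d where d: "\<And>e. degree (f e) \<le> d"
    using assms by (auto simp: coeffs_in_def)
  have "degree (pderiv (f e)) \<le> d" for e
    using d[of e] by (simp add: degree_pderiv)
  moreover have "(\<lambda>e. coeff (pderiv (f e)) i) \<in> poly_in S" for i
    unfolding coeff_pderiv by (intro poly_in.mult poly_in.const coeffs_in_coeff assms)
  ultimately show ?thesis by (auto simp: coeffs_in_def)
qed

section \<open>Sign tables and their dependence on the parameters\<close>

definition same_signs :: "('e \<Rightarrow> real) set \<Rightarrow> 'e \<Rightarrow> 'e \<Rightarrow> bool" where
  "same_signs G e e' \<longleftrightarrow> (\<forall>g\<in>G. sgn (g e) = sgn (g e'))"

text \<open>Two families of univariate polynomials have the same sign table iff an increasing bijection of
  the line carries the signs of one to those of the other.\<close>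

definition table_determined :: "'v set \<Rightarrow> (('v \<Rightarrow> real) \<Rightarrow> real poly) set \<Rightarrow> ('v \<Rightarrow> real) set \<Rightarrow> bool" where
  "table_determined S F Y \<longleftrightarrow> (\<exists>G. finite G \<and> G \<subseteq> poly_in S \<and>
     (\<forall>e\<in>Y. \<forall>e'\<in>Y. same_signs G e e' \<longrightarrow>
        (\<exists>\<phi>::real \<Rightarrow> real. strict_mono \<phi> \<and> surj \<phi> \<and> (\<forall>f\<in>F. \<forall>y. sgn (poly (f e) y) = sgn (poly (f e') (\<phi> y))))))"

lemma finite_sign_classes:
  assumes "finite C"
  shows "finite ((\<lambda>e0. {e\<in>Y. same_signs C e e0}) ` Y)"
proof -
  define s where "s e0 = restrict (\<lambda>c. sgn (c e0)) C" for e0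
  have "s ` Y \<subseteq> C \<rightarrow>\<^sub>E {-1, 0, 1}" by (auto simp: s_def sgn_if split: if_splits)
  then have "finite (s ` Y)" using assms finite_PiE[of C] by (meson finite.intros finite_subset)
  moreover have "(\<lambda>e0. {e\<in>Y. same_signs C e e0}) ` Y = (\<lambda>\<sigma>. {e\<in>Y. \<forall>c\<in>C. sgn (c e) = \<sigma> c}) ` s ` Y"
    by (auto simp: s_def same_signs_def image_image intro!: image_cong)
  ultimately show ?thesis by simp
qed

text \<open>Equal signs on \<open>C\<close> already put two parameters into one class, and there are
  only finitely many classes, so \<open>C\<close> joined with the determining sets of all classes
  serves for \<open>Y\<close>. Hence one may assume that the signs of finitely many parameter
  polynomials are constant.\<close>

lemma table_determined_split:
  assumes C: "finite C" "C \<subseteq> poly_in S"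
    and det: "\<And>e0. e0 \<in> Y \<Longrightarrow> table_determined S F {e\<in>Y. same_signs C e e0}"
  shows "table_determined S F Y"
proof -
  define \<W> where "\<W> = (\<lambda>e0. {e\<in>Y. same_signs C e e0}) ` Y"
  have "\<forall>W\<in>\<W>. \<exists>G. finite G \<and> G \<subseteq> poly_in S \<and>
     (\<forall>e\<in>W. \<forall>e'\<in>W. same_signs G e e' \<longrightarrow>
        (\<exists>\<phi>::real \<Rightarrow> real. strict_mono \<phi> \<and> surj \<phi> \<and> (\<forall>f\<in>F. \<forall>y. sgn (poly (f e) y) = sgn (poly (f e') (\<phi> y)))))"
    using det unfolding \<W>_def table_determined_def by blast
  then obtain G where G: "\<And>W. W \<in> \<W> \<Longrightarrow> finite (G W)" "\<And>W. W \<in> \<W> \<Longrightarrow> G W \<subseteq> poly_in S"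
     "\<And>W e e'. W \<in> \<W> \<Longrightarrow> e \<in> W \<Longrightarrow> e' \<in> W \<Longrightarrow> same_signs (G W) e e' \<Longrightarrow>
        (\<exists>\<phi>::real \<Rightarrow> real. strict_mono \<phi> \<and> surj \<phi> \<and> (\<forall>f\<in>F. \<forall>y. sgn (poly (f e) y) = sgn (poly (f e') (\<phi> y))))"
    by metis
  have "finite \<W>" unfolding \<W>_def using C(1) by (rule finite_sign_classes)
  show ?thesis
    unfolding table_determined_def
  proof (intro exI[of _ "C \<union> (\<Union>W\<in>\<W>. G W)"] conjI ballI impI)
    show "finite (C \<union> (\<Union>W\<in>\<W>. G W))" using C G \<open>finite \<W>\<close> by auto
    show "C \<union> (\<Union>W\<in>\<W>. G W) \<subseteq> poly_in S" using C G by auto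
    fix e e' assume e: "e \<in> Y" "e' \<in> Y" and ss: "same_signs (C \<union> (\<Union>W\<in>\<W>. G W)) e e'"
    define W where "W = {d\<in>Y. same_signs C d e'}"
    have "W \<in> \<W>" "e \<in> W" "e' \<in> W" using e ss by (auto simp: W_def \<W>_def same_signs_def)
    moreover have "same_signs (G W) e e'" using ss \<open>W \<in> \<W>\<close> by (auto simp: same_signs_def)
    ultimately show "\<exists>\<phi>::real \<Rightarrow> real. strict_mono \<phi> \<and> surj \<phi> \<and> (\<forall>f\<in>F. \<forall>y. sgn (poly (f e) y) = sgn (poly (f e') (\<phi> y)))"
      by (rule G(3))
  qed
qed

lemma degree_eq_if_coeff_zeros_eq:
  assumes "degree p \<le> D" "degree q \<le> D" "\<And>i. i \<le> D \<Longrightarrow> coeff p i = 0 \<longleftrightarrow> coeff q i = 0"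
  shows "degree p = degree q"
proof -
  have "coeff p i = 0 \<longleftrightarrow> coeff q i = 0" for i
    using assms by (cases "i \<le> D") (auto simp: coeff_eq_0)
  then show ?thesis by (simp add: degree_def)
qed

text \<open>The inductive step of Cohen and Hoermander: a polynomial p of maximal degree is traded for its
  derivative and for the results \<open>h f\<close> of cancelling the leading term of p against \<open>f\<close>, which
  determine the sign of p at the zeros of \<open>f\<close>.\<close>

lemma sign_table_extends:
  fixes F0 :: "'f set" and P Q :: "'f \<Rightarrow> real poly" and p q :: "real poly"
  defines "h \<equiv> \<lambda>p f. smult (lead_coeff f) p - smult (lead_coeff p) (monom 1 (degree p - degree f) * f)"
  assumes "finite F0" and deg: "degree p > 0" "degree q > 0"
    and der: "f' \<in> F0" "P f' = pderiv p" "Q f' = pderiv q"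
    and lc: "\<And>f. f \<in> F0 \<Longrightarrow> sgn (lead_coeff (P f)) = sgn (lead_coeff (Q f))"
    and \<phi>: "strict_mono \<phi>" "surj \<phi>"
    and table: "\<And>f y. f \<in> F0 \<Longrightarrow> sgn (poly (P f) y) = sgn (poly (Q f) (\<phi> y))"
    and htable: "\<And>f y. f \<in> F0 \<Longrightarrow> sgn (poly (h p (P f)) y) = sgn (poly (h q (Q f)) (\<phi> y))"
  shows "\<exists>\<psi>. strict_mono \<psi> \<and> surj \<psi> \<and> (\<forall>y. sgn (poly p y) = sgn (poly q (\<psi> y))) \<and>
           (\<forall>f\<in>F0. \<forall>y. sgn (poly (P f) y) = sgn (poly (Q f) (\<psi> y)))"
proof -
  \<comment> \<open>Identically vanishing \<open>P f\<close> are left out to keep \<open>Z\<close>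
    finite; their partners \<open>Q f\<close> vanish too, because the signs of the leading
    coefficients agree.\<close>
  define Z where "Z = (\<Union>f\<in>{f\<in>F0. P f \<noteq> 0}. {y. poly (P f) y = 0})"
  have "pderiv p \<noteq> 0" using deg by (simp add: pderiv_eq_0_iff)
  interpret sign_match Z \<phi> p q
  proof
    show "finite Z" using \<open>finite F0\<close> poly_roots_finite by (auto simp: Z_def)
    show "y \<in> Z" if "poly (pderiv p) y = 0" for y
      using that der \<open>pderiv p \<noteq> 0\<close> by (auto simp: Z_def intro!: bexI[of _ f'])
    show "sgn (poly (pderiv p) y) = sgn (poly (pderiv q) (\<phi> y))" for y
      using table[OF der(1)] der by simp
    fix z assume "z \<in> Z"
    then obtain f where f: "f \<in> F0" "P f \<noteq> 0" "poly (P f) z = 0" by (auto simp: Z_def)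
    then have "poly (Q f) (\<phi> z) = 0" using table[OF f(1), of z] by (simp add: sgn_0_0)
    \<comment> \<open>At a zero of \<open>P f\<close> the subtracted multiple of \<open>P f\<close>
      drops out, leaving the leading coefficient of \<open>P f\<close> times the value of
      \<open>p\<close>; that coefficient is nonzero and has a matched sign, so it can be
      cancelled.\<close>
    then have "sgn (lead_coeff (P f)) * sgn (poly p z) = sgn (lead_coeff (Q f)) * sgn (poly q (\<phi> z))"
      using htable[OF f(1), of z] f(3) by (simp add: h_def sgn_mult)
    then show "sgn (poly p z) = sgn (poly q (\<phi> z))"
      using lc[OF f(1)] f(2) by (metis leading_coeff_0_iff mult_cancel_left sgn_0_0)
  qed (use deg \<phi> in auto)
  obtain \<psi> where \<psi>: "strict_mono \<psi>" "surj \<psi>" "\<And>z. z \<in> Z \<Longrightarrow> \<psi> z = \<phi> z"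
    "\<And>y. sgn (poly p y) = sgn (poly q (\<psi> y))"
    using transfer by blast
  have "sgn (poly (P f) y) = sgn (poly (Q f) (\<psi> y))" if "f \<in> F0" for f y
  proof (cases "P f = 0")
    case True
    then have "Q f = 0" using lc[OF that] by (simp add: sgn_0_0)
    with True show ?thesis by simp
  next
    case False
    have "x \<in> \<phi> ` Z" if x: "poly (Q f) x = 0" for x
    proof -
      obtain w where w: "x = \<phi> w" using \<phi>(2) by auto
      then have "poly (P f) w = 0" using table[OF \<open>f \<in> F0\<close>, of w] x by (simp add: sgn_0_0)
      then have "w \<in> Z" using False \<open>f \<in> F0\<close> by (auto simp: Z_def)
      then show ?thesis using w by simp
    qed
    then have "sgn (poly (Q f) (\<psi> y)) = sgn (poly (Q f) (\<phi> y))"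
      using sgn_poly_cong_if_agree_on_zeros[OF \<phi>(1) \<psi>(1) \<psi>(3)] by blast
    then show ?thesis using table[OF that] by simp
  qed
  then show ?thesis using \<psi> by blast
qed

text \<open>The coefficients at \<open>degree p\<close> cancel. If everything cancels, the result
  has degree 0, and positivity of \<open>degree p\<close> still makes this a strict drop.\<close>

lemma degree_lead_cancel_less:
  fixes p f :: "real poly"
  assumes "degree f \<le> degree p" "degree p > 0"
  shows "degree (smult (lead_coeff f) p - smult (lead_coeff p) (monom 1 (degree p - degree f) * f)) < degree p"
proof -
  let ?h = "smult (lead_coeff f) p - smult (lead_coeff p) (monom 1 (degree p - degree f) * f)"
  have "degree (monom 1 (degree p - degree f) * f) \<le> degree p"
    using degree_mult_le[of "monom 1 (degree p - degree f)" f] degree_monom_le[of "1::real" "degree p - degree f"] assms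
    by linarith
  then have "degree ?h \<le> degree p"
    by (meson degree_diff_le degree_smult_le order_trans)
  moreover have "coeff ?h (degree p) = 0"
    using assms by (simp add: coeff_monom_mult)
  ultimately show ?thesis
    using assms(2) by (metis degree_0 leading_coeff_0_iff order_le_less)
qed

text \<open>The outer induction is on the degree bound, the inner one on how many members of
  \<open>F\<close> reach it somewhere on \<open>Y\<close>. On a class with constant coefficient
  signs, one such member is exchanged for polynomials of smaller degree: the family may grow, but
  the inner count drops.\<close>

lemma table_determined_by_params:
  assumes "finite F" "F \<subseteq> coeffs_in S" "\<And>f e. f \<in> F \<Longrightarrow> e \<in> Y \<Longrightarrow> degree (f e) \<le> D"
  shows "table_determined S F Y"
  using assms
proof (induction D arbitrary: F Y)
  case 0
  show ?case
    unfolding table_determined_def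
  proof (intro exI[of _ "(\<lambda>f e. coeff (f e) 0) ` F"] conjI ballI impI)
    show "finite ((\<lambda>f e. coeff (f e) 0) ` F)" using 0 by simp
    show "(\<lambda>f e. coeff (f e) 0) ` F \<subseteq> poly_in S" using 0(2) by (auto intro: coeffs_in_coeff)
    fix e e' assume e: "e \<in> Y" "e' \<in> Y" "same_signs ((\<lambda>f e. coeff (f e) 0) ` F) e e'"
    have "poly (f d) y = coeff (f d) 0" if fd: "f \<in> F" "d \<in> Y" for f d y
    proof -
      obtain a where "f d = [:a:]" using 0(3)[OF fd] degree_eq_zeroE by (metis le_zero_eq)
      then show ?thesis by simp
    qed
    then have "\<forall>f\<in>F. \<forall>y. sgn (poly (f e) y) = sgn (poly (f e') (id y))"
      using e by (auto simp: same_signs_def)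
    then show "\<exists>\<phi>::real \<Rightarrow> real. strict_mono \<phi> \<and> surj \<phi> \<and> (\<forall>f\<in>F. \<forall>y. sgn (poly (f e) y) = sgn (poly (f e') (\<phi> y)))"
      by (intro exI[of _ id]) (auto simp: strict_mono_def)
  qed
next
  case (Suc D)
  note outer = Suc.IH
  show ?case
    using Suc.prems
  proof (induction "card {f\<in>F. \<exists>e\<in>Y. degree (f e) = Suc D}" arbitrary: F Y rule: less_induct)
    case (less F Y)
    define C where "C = (\<lambda>(f, i) e. coeff (f e) i) ` (F \<times> {..Suc D})"
    show ?case
    proof (rule table_determined_split[of C])
      show "finite C" using less.prems by (auto simp: C_def)
      show "C \<subseteq> poly_in S" using less.prems coeffs_in_coeff by (fastforce simp: C_def)
      fix e0 assume "e0 \<in> Y"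
      define W where "W = {e \<in> Y. same_signs C e e0}"
      have coeff_sgn: "sgn (coeff (f e) i) = sgn (coeff (f e0) i)" if "f \<in> F" "e \<in> W" "i \<le> Suc D" for f e i
        using that by (force simp: W_def same_signs_def C_def)
      have degW: "degree (f e) = degree (f e0)" if "f \<in> F" "e \<in> W" for f e
      proof (rule degree_eq_if_coeff_zeros_eq)
        show "degree (f e) \<le> Suc D" "degree (f e0) \<le> Suc D"
          using that less.prems(3) \<open>e0 \<in> Y\<close> by (auto simp: W_def)
        show "coeff (f e) i = 0 \<longleftrightarrow> coeff (f e0) i = 0" if "i \<le> Suc D" for i
          using coeff_sgn[OF \<open>f \<in> F\<close> \<open>e \<in> W\<close> that] by (metis sgn_0_0)
      qed
      have lcW: "sgn (lead_coeff (f e)) = sgn (lead_coeff (f e0))" if "f \<in> F" "e \<in> W" for f e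
        using coeff_sgn[OF that] degW[OF that] less.prems(3) \<open>e0 \<in> Y\<close> that by auto
      have "table_determined S F W"
      proof (cases "\<exists>p\<in>F. degree (p e0) = Suc D")
        case False
        have "degree (f e) \<le> D" if "f \<in> F" "e \<in> W" for f e
          using False degW[OF that] less.prems(3)[OF that(1) \<open>e0 \<in> Y\<close>] that by (metis le_SucE)
        then show ?thesis using less.prems outer by blast
      next
        case True
        then obtain p where p: "p \<in> F" "degree (p e0) = Suc D" by blast
        define p' where "p' = (\<lambda>e. pderiv (p e))"
        define F0 where "F0 = insert p' (F - {p})"
        define h where "h f e = smult (lead_coeff (f e)) (p e) -
          smult (lead_coeff (p e)) (monom 1 (degree (p e) - degree (f e)) * f e)" for f e
        \<comment> \<open>In \<open>h\<close> the degrees, and with them the choice of leading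
          coefficients, vary with the parameter, so its coefficients need not be polynomial in it.
          \<open>k\<close> freezes the degrees at their values for \<open>e0\<close>; on
          \<open>W\<close> they are constant and the two agree.\<close>
        define k where "k f = (\<lambda>e. smult (coeff (f e) (degree (f e0))) (p e) -
          smult (coeff (p e) (Suc D)) (monom 1 (Suc D - degree (f e0)) * f e))" for f
        have pW: "degree (p e) = Suc D" if "e \<in> W" for e using degW[OF p(1) that] p(2) by simp
        have degF0: "degree (f e) = degree (f e0)" "degree (f e) \<le> Suc D"
            "sgn (lead_coeff (f e)) = sgn (lead_coeff (f e0))" if "f \<in> F0" "e \<in> W" for f e
        proof -
          have d: "degree (p' d) = D" if "d \<in> W" for d using pW[OF that] by (simp add: p'_def degree_pderiv)
          have l: "lead_coeff (p' d) = of_nat (Suc D) * lead_coeff (p d)" if "d \<in> W" for d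
            using d[OF that] pW[OF that] by (simp add: p'_def coeff_pderiv)
          have "e0 \<in> W" using \<open>e0 \<in> Y\<close> by (simp add: W_def same_signs_def)
          show "degree (f e) = degree (f e0)"
            using that degW d \<open>e0 \<in> W\<close> by (auto simp: F0_def)
          show "degree (f e) \<le> Suc D"
            using that d less.prems(3) by (auto simp: F0_def W_def)
          show "sgn (lead_coeff (f e)) = sgn (lead_coeff (f e0))"
          proof (cases "f = p'")
            case True
            then show ?thesis using l[OF \<open>e0 \<in> W\<close>] l[OF \<open>e \<in> W\<close>] lcW[OF p(1) \<open>e \<in> W\<close>] by (simp only: sgn_mult)
          next
            case False
            then show ?thesis using that lcW by (auto simp: F0_def)
          qed
        qed
        have kh: "k f e = h f e" if "f \<in> F0" "e \<in> W" for f e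
          using degF0(1)[OF that] pW[OF that(2)] by (simp add: k_def h_def)
        have degk: "degree (k f e) < Suc D" if "f \<in> F0" "e \<in> W" for f e
          using degree_lead_cancel_less[of "f e" "p e"] degF0(2)[OF that] pW[OF that(2)] kh[OF that]
          by (simp add: h_def)
        have degp': "degree (p' e) < Suc D" if "e \<in> W" for e
          using pW[OF that] by (simp add: p'_def degree_pderiv)
        have "table_determined S (F0 \<union> k ` F0) W"
        proof (rule less.hyps)
          let ?M = "{f\<in>F0 \<union> k ` F0. \<exists>e\<in>W. degree (f e) = Suc D}"
          have "?M \<subseteq> {f\<in>F. \<exists>e\<in>Y. degree (f e) = Suc D} - {p}"
          proof
            fix f assume "f \<in> ?M"
            then obtain e where f: "f \<in> F0 \<union> k ` F0" "e \<in> W" "degree (f e) = Suc D" by blast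
            have "f \<notin> k ` F0" using degk f(2,3) by (metis imageE less_irrefl)
            moreover have "f \<noteq> p'" using degp' f(2,3) by (metis less_irrefl)
            ultimately have "f \<in> F - {p}" using f(1) by (auto simp: F0_def)
            moreover have "e \<in> Y" using f(2) by (simp add: W_def)
            ultimately show "f \<in> {f\<in>F. \<exists>e\<in>Y. degree (f e) = Suc D} - {p}" using f(3) by blast
          qed
          moreover have "p \<in> {f\<in>F. \<exists>e\<in>Y. degree (f e) = Suc D}" using p \<open>e0 \<in> Y\<close> by auto
          ultimately have "?M \<subset> {f\<in>F. \<exists>e\<in>Y. degree (f e) = Suc D}" by blast
          then show "card ?M < card {f\<in>F. \<exists>e\<in>Y. degree (f e) = Suc D}"
            using less.prems(1) by (intro psubset_card_mono) auto
          show "finite (F0 \<union> k ` F0)" using less.prems(1) by (auto simp: F0_def)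
          have "F0 \<subseteq> coeffs_in S" using less.prems(2) p(1) by (auto simp: F0_def p'_def intro: coeffs_in_pderiv)
          moreover have "k f \<in> coeffs_in S" if "f \<in> coeffs_in S" for f
            unfolding k_def using that less.prems(2) p(1)
            by (intro coeffs_in_diff coeffs_in_smult coeffs_in_mult coeffs_in_coeff coeffs_in_const) auto
          ultimately show "F0 \<union> k ` F0 \<subseteq> coeffs_in S" by auto
          show "degree (f e) \<le> Suc D" if "f \<in> F0 \<union> k ` F0" "e \<in> W" for f e
            using that degF0(2) degk less_imp_le by blast
        qed
        then obtain G where G: "finite G" "G \<subseteq> poly_in S" and
          Gdet: "\<And>e e'. e \<in> W \<Longrightarrow> e' \<in> W \<Longrightarrow> same_signs G e e' \<Longrightarrow>
             (\<exists>\<phi>::real \<Rightarrow> real. strict_mono \<phi> \<and> surj \<phi> \<and> (\<forall>f\<in>F0 \<union> k ` F0. \<forall>y. sgn (poly (f e) y) = sgn (poly (f e') (\<phi> y))))"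
          unfolding table_determined_def by meson
        show ?thesis
          unfolding table_determined_def
        proof (intro exI[of _ G] conjI ballI impI G)
          fix e e' assume e: "e \<in> W" "e' \<in> W" "same_signs G e e'"
          obtain \<phi> :: "real \<Rightarrow> real" where \<phi>: "strict_mono \<phi>" "surj \<phi>"
            "\<And>f y. f \<in> F0 \<union> k ` F0 \<Longrightarrow> sgn (poly (f e) y) = sgn (poly (f e') (\<phi> y))"
            using Gdet[OF e] by blast
          have "\<exists>\<psi>. strict_mono \<psi> \<and> surj \<psi> \<and> (\<forall>y. sgn (poly (p e) y) = sgn (poly (p e') (\<psi> y))) \<and>
             (\<forall>f\<in>F0. \<forall>y. sgn (poly (f e) y) = sgn (poly (f e') (\<psi> y)))"
          proof (rule sign_table_extends[where f' = p' and \<phi> = \<phi>])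
            show "finite F0" using less.prems(1) by (simp add: F0_def)
            show "degree (p e) > 0" "degree (p e') > 0" using pW e by auto
            show "p' \<in> F0" by (simp add: F0_def)
            show "p' e = pderiv (p e)" "p' e' = pderiv (p e')" by (simp_all add: p'_def)
            show "sgn (lead_coeff (f e)) = sgn (lead_coeff (f e'))" if "f \<in> F0" for f
              using degF0(3)[OF that] e by simp
            show "sgn (poly (f e) y) = sgn (poly (f e') (\<phi> y))" if "f \<in> F0" for f y
              using \<phi>(3) that by blast
            fix f y assume "f \<in> F0"
            then have "sgn (poly (h f e) y) = sgn (poly (h f e') (\<phi> y))"
              using \<phi>(3)[of "k f" y] kh e by auto
            then show "sgn (poly (smult (lead_coeff (f e)) (p e) - smult (lead_coeff (p e)) (monom 1 (degree (p e) - degree (f e)) * f e)) y) =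
               sgn (poly (smult (lead_coeff (f e')) (p e') - smult (lead_coeff (p e')) (monom 1 (degree (p e') - degree (f e')) * f e')) (\<phi> y))"
              by (simp only: h_def)
          qed (use \<phi> in auto)
          then show "\<exists>\<phi>::real \<Rightarrow> real. strict_mono \<phi> \<and> surj \<phi> \<and> (\<forall>f\<in>F. \<forall>y. sgn (poly (f e) y) = sgn (poly (f e') (\<phi> y)))"
            unfolding F0_def by (metis Diff_iff insert_iff singletonD)
        qed
      qed
      then show "table_determined S F {e \<in> Y. same_signs C e e0}" by (simp add: W_def)
    qed
  qed
qed

section \<open>Back-and-forth elimination of variables\<close>

lemma poly_in_insert_as_poly:
  assumes "f \<in> poly_in (insert i S)"
  shows "\<exists>a\<in>coeffs_in S. \<forall>e y. f (e(i := y)) = poly (a e) y"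
  using assms
proof (induction rule: poly_in.induct)
  case (const c)
  show ?case by (rule bexI[OF _ coeffs_in_const[of "[:c:]"]]) simp
next
  case (var v)
  show ?case
  proof (cases "v = i")
    case True
    then show ?thesis by (intro bexI[OF _ coeffs_in_const[of "[:0, 1:]"]]) simp
  next
    case False
    then show ?thesis using var by (intro bexI[of _ "\<lambda>e. [:e v:]"] coeffs_in_pCons poly_in.var) auto
  qed
next
  case (add f g)
  then obtain a b where "a \<in> coeffs_in S" "b \<in> coeffs_in S"
    "\<And>e y. f (e(i := y)) = poly (a e) y" "\<And>e y. g (e(i := y)) = poly (b e) y" by blast
  then show ?case by (intro bexI[of _ "\<lambda>e. a e + b e"] coeffs_in_add) (simp_all only: poly_add simp_thms)
next
  case (mult f g)
  then obtain a b where "a \<in> coeffs_in S" "b \<in> coeffs_in S"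
    "\<And>e y. f (e(i := y)) = poly (a e) y" "\<And>e y. g (e(i := y)) = poly (b e) y" by blast
  then show ?case by (intro bexI[of _ "\<lambda>e. a e * b e"] coeffs_in_mult) (simp_all only: poly_mult simp_thms)
qed

text \<open>As functions of the value at \<open>i\<close>, the members of \<open>F\<close> are
  univariate polynomials, and the partner of \<open>y\<close> is its image under the bijection
  matching the tables of \<open>e\<close> and \<open>e'\<close>. Consequently, if the signs of
  \<open>F\<close> decide a condition, the signs of \<open>G\<close> decide whether some value at
  \<open>i\<close> satisfies it.\<close>

lemma eliminate_variable:
  assumes "finite F" "F \<subseteq> poly_in (insert i S)"
  shows "\<exists>G. finite G \<and> G \<subseteq> poly_in S \<and>
    (\<forall>e e' y. same_signs G e e' \<longrightarrow> (\<exists>y'. same_signs F (e(i := y)) (e'(i := y'))))"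
proof -
  have "\<forall>f\<in>F. \<exists>a. a \<in> coeffs_in S \<and> (\<forall>e y. f (e(i := y)) = poly (a e) y)"
  proof
    fix f assume "f \<in> F"
    with assms(2) have "f \<in> poly_in (insert i S)" by (rule subsetD)
    from poly_in_insert_as_poly[OF this]
    show "\<exists>a. a \<in> coeffs_in S \<and> (\<forall>e y. f (e(i := y)) = poly (a e) y)" by (simp only: Bex_def)
  qed
  from bchoice[OF this]
  obtain a where *: "\<forall>f\<in>F. a f \<in> coeffs_in S \<and> (\<forall>e y. f (e(i := y)) = poly (a f e) y)" ..
  have a: "a f \<in> coeffs_in S" "f (e(i := y)) = poly (a f e) y" if "f \<in> F" for f e y
    using bspec[OF * that] by simp_all
  have "\<forall>f\<in>F. \<exists>d. \<forall>e. degree (a f e) \<le> d" using a(1) unfolding coeffs_in_def by blast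
  from bchoice[OF this] obtain d where d: "\<And>f e. f \<in> F \<Longrightarrow> degree (a f e) \<le> d f" by blast
  have "table_determined S (a ` F) UNIV"
  proof (rule table_determined_by_params)
    show "degree (f e) \<le> Max (d ` F)" if f: "f \<in> a ` F" for f e
    proof -
      obtain g where g: "g \<in> F" "f = a g" using f by blast
      then have "d g \<le> Max (d ` F)" using assms(1) by simp
      then show ?thesis using d[OF g(1)] g(2) order_trans by blast
    qed
    show "finite (a ` F)" "a ` F \<subseteq> coeffs_in S" using assms(1) a(1) by blast+
  qed
  then obtain G where G: "finite G" "G \<subseteq> poly_in S" and det: "\<forall>e\<in>UNIV. \<forall>e'\<in>UNIV. same_signs G e e' \<longrightarrow>
        (\<exists>\<phi>::real \<Rightarrow> real. strict_mono \<phi> \<and> surj \<phi> \<and> (\<forall>f\<in>a ` F. \<forall>y. sgn (poly (f e) y) = sgn (poly (f e') (\<phi> y))))"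
    unfolding table_determined_def by (elim exE conjE)
  have "\<exists>y'. same_signs F (e(i := y)) (e'(i := y'))" if ss: "same_signs G e e'" for e e' y
  proof -
    obtain \<phi> :: "real \<Rightarrow> real" where "\<forall>f\<in>a ` F. \<forall>y. sgn (poly (f e) y) = sgn (poly (f e') (\<phi> y))"
      using det[rule_format, OF UNIV_I UNIV_I ss] by (elim exE conjE)
    then show ?thesis by (intro exI[of _ "\<phi> y"]) (simp add: same_signs_def a(2) del: fun_upd_apply)
  qed
  with G show ?thesis by (intro exI[of _ G]) simp
qed

text \<open>In the inductive step the value at \<open>i\<close> is matched first; the induction
  hypothesis, with \<open>i\<close> counted among the parameters, then supplies the values on
  \<open>V\<close>.\<close>

lemma eliminate_variables:
  assumes "finite V" "finite F" "F \<subseteq> poly_in (V \<union> T)"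
  shows "\<exists>G. finite G \<and> G \<subseteq> poly_in T \<and>
    (\<forall>e e' d. same_signs G e e' \<longrightarrow> (\<forall>v. v \<notin> V \<longrightarrow> d v = e v) \<longrightarrow>
       (\<exists>d'. (\<forall>v. v \<notin> V \<longrightarrow> d' v = e' v) \<and> same_signs F d d'))"
  using assms
proof (induction V arbitrary: T rule: finite_induct)
  case empty
  have "same_signs F d e'" if "same_signs F e e'" "\<forall>v. d v = e v" for d e e'
    using that by (metis ext)
  with empty show ?case by (intro exI[of _ F]) auto
next
  case (insert i V)
  have "F \<subseteq> poly_in (V \<union> insert i T)" using insert.prems by simp
  from insert.IH[OF insert.prems(1) this]
  obtain G1 where G1: "finite G1" "G1 \<subseteq> poly_in (insert i T)" and det1:
    "\<forall>e e' d. same_signs G1 e e' \<longrightarrow> (\<forall>v. v \<notin> V \<longrightarrow> d v = e v) \<longrightarrow>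
       (\<exists>d'. (\<forall>v. v \<notin> V \<longrightarrow> d' v = e' v) \<and> same_signs F d d')"
    by (elim exE conjE)
  from eliminate_variable[OF G1] obtain G where G: "finite G" "G \<subseteq> poly_in T" and det:
     "\<forall>e e' y. same_signs G e e' \<longrightarrow> (\<exists>y'. same_signs G1 (e(i := y)) (e'(i := y')))"
    by (elim exE conjE)
  have "\<exists>d'. (\<forall>v. v \<notin> insert i V \<longrightarrow> d' v = e' v) \<and> same_signs F d d'"
    if ss: "same_signs G e e'" and d: "\<forall>v. v \<notin> insert i V \<longrightarrow> d v = e v" for e e' d
  proof -
    obtain y' where y': "same_signs G1 (e(i := d i)) (e'(i := y'))" using det[rule_format, OF ss] ..
    have "\<forall>v. v \<notin> V \<longrightarrow> d v = (e(i := d i)) v" using d by auto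
    from det1[THEN spec, THEN spec, THEN spec, THEN mp, THEN mp, OF y' this]
    obtain d' where "\<forall>v. v \<notin> V \<longrightarrow> d' v = (e'(i := y')) v" "same_signs F d d'"
      by (elim exE conjE)
    then show ?thesis by (intro exI[of _ d']) auto
  qed
  with G show ?case by (intro exI[of _ G]) simp
qed

section \<open>Eventual truth along a growing scale\<close>

lemma eventually_sgn_poly_const:
  fixes p :: "real poly"
  shows "\<exists>s. eventually (\<lambda>t. sgn (poly p t) = s) at_top"
proof -
  have *: "eventually (\<lambda>t. poly q t > 0) at_top" if "lead_coeff q > 0" for q :: "real poly"
  proof -
    obtain n where "\<And>x. x \<ge> n \<Longrightarrow> poly q x \<ge> lead_coeff q"
      using poly_pinfty_gt_lc[OF \<open>lead_coeff q > 0\<close>] by blast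
    then show ?thesis using that by (auto simp: eventually_at_top_linorder intro: less_le_trans)
  qed
  consider "p = 0" | "lead_coeff p > 0" | "lead_coeff (- p) > 0"
    by (metis less_minus_iff lead_coeff_minus leading_coeff_0_iff linorder_neqE_linordered_idom neg_equal_0_iff_equal minus_zero)
  then show ?thesis
  proof cases
    case 2
    from *[OF this] show ?thesis by (intro exI[of _ 1]) (auto elim: eventually_mono)
  next
    case 3
    from *[OF this] show ?thesis by (intro exI[of _ "-1"]) (auto elim: eventually_mono)
  qed auto
qed

lemma poly_in_singleton_as_poly:
  assumes "f \<in> poly_in {v}"
  shows "\<exists>p. \<forall>e. f e = poly p (e v)"
  using assms
proof (induction rule: poly_in.induct)
  case (const c)
  show ?case by (rule exI[of _ "[:c:]"]) simp
next
  case (var w)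
  then show ?case by (intro exI[of _ "[:0, 1:]"]) simp
next
  case (add f g)
  then show ?case by (metis poly_add)
next
  case (mult f g)
  then show ?case by (metis poly_mult)
qed

text \<open>Once all variables but \<open>v\<close> are eliminated, truth at \<open>t\<close>
  depends on the signs of finitely many univariate polynomials in \<open>t\<close>, all constant
  beyond some \<open>t0\<close>. A witness at one scale beyond \<open>t0\<close> can then be
  transported to every other.\<close>

lemma projection_eventually_const:
  fixes Q :: "('v::finite \<Rightarrow> real) \<Rightarrow> bool" and v :: 'v
  assumes "finite F" "F \<subseteq> poly_in UNIV" and Q: "\<And>d d'. same_signs F d d' \<Longrightarrow> Q d \<Longrightarrow> Q d'"
  shows "eventually (\<lambda>t. \<exists>d. d v = t \<and> Q d) at_top \<or> eventually (\<lambda>t. \<not> (\<exists>d. d v = t \<and> Q d)) at_top"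
proof -
  have "F \<subseteq> poly_in (- {v} \<union> {v})" using assms(2) by (simp add: Un_commute)
  from eliminate_variables[OF finite assms(1) this] obtain G where G: "finite G" "G \<subseteq> poly_in {v}" and det:
    "\<forall>e e' d. same_signs G e e' \<longrightarrow> (\<forall>w. w \<notin> - {v} \<longrightarrow> d w = e w) \<longrightarrow>
       (\<exists>d'. (\<forall>w. w \<notin> - {v} \<longrightarrow> d' w = e' w) \<and> same_signs F d d')"
    by (elim exE conjE)
  \<comment> \<open>Members of \<open>G\<close> see only the variable \<open>v\<close>, so the
    constant assignment stands for every assignment with value \<open>t\<close> at
    \<open>v\<close>.\<close>
  have "\<forall>g\<in>G. \<exists>s. eventually (\<lambda>t. sgn (g (\<lambda>_. t)) = s) at_top"
  proof
    fix g assume "g \<in> G"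
    from poly_in_singleton_as_poly[OF subsetD[OF G(2) this]] obtain p where "\<forall>e. g e = poly p (e v)" ..
    then show "\<exists>s. eventually (\<lambda>t. sgn (g (\<lambda>_. t)) = s) at_top" using eventually_sgn_poly_const[of p] by simp
  qed
  from bchoice[OF this] obtain s where "\<forall>g\<in>G. eventually (\<lambda>t. sgn (g (\<lambda>_. t)) = s g) at_top" ..
  then have "eventually (\<lambda>t. \<forall>g\<in>G. sgn (g (\<lambda>_. t)) = s g) at_top"
    using G(1) by (simp add: eventually_ball_finite)
  then obtain t0 where t0: "\<forall>t\<ge>t0. \<forall>g\<in>G. sgn (g (\<lambda>_. t)) = s g"
    unfolding eventually_at_top_linorder ..
  have transfer: "\<exists>d. d v = t' \<and> Q d" if "t \<ge> t0" "t' \<ge> t0" "d v = t" "Q d" for t t' d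
  proof -
    have "same_signs G (\<lambda>_. t) (\<lambda>_. t')" using t0 that by (simp add: same_signs_def)
    from det[THEN spec, THEN spec, THEN spec, THEN mp, OF this, of d] that(3)
    obtain d' where "d' v = t'" "same_signs F d d'" by auto
    then show ?thesis using Q[OF _ that(4)] by (intro exI[of _ d'] conjI)
  qed
  show ?thesis
  proof (cases "\<exists>d. d v \<ge> t0 \<and> Q d")
    case True
    then have "\<forall>t\<ge>t0. \<exists>d. d v = t \<and> Q d" using transfer by blast
    then show ?thesis by (auto simp: eventually_at_top_linorder)
  next
    case False
    then have "\<forall>t\<ge>t0. \<not> (\<exists>d. d v = t \<and> Q d)" by blast
    then show ?thesis unfolding eventually_at_top_linorder by (intro disjI2 exI[of _ t0])
  qed
qed

section \<open>The tangent cone at infinity\<close>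

definition link :: "'a::real_normed_vector set \<Rightarrow> real \<Rightarrow> 'a set" where
  "link X t = (\<lambda>x. (1 / t) *\<^sub>R x) ` (X \<inter> {x. norm x = t})"

lemma norm_link: "y \<in> link X t \<Longrightarrow> t > 0 \<Longrightarrow> norm y = 1"
  by (auto simp: link_def)

text \<open>This zero-one law for balls is all that the cone needs from semialgebraicity. It rules
  out sets such as a logarithmic spiral, whose link keeps rotating, so that its limit depends on the
  chosen scales.\<close>

locale conic_at_infinity =
  fixes X :: "'a::euclidean_space set"
  assumes unbounded: "\<not> bounded X"
    and near_or_far: "\<And>v r. r > 0 \<Longrightarrow> (\<forall>\<^sub>F t in at_top. \<exists>y\<in>link X t. dist y v < r) \<or>
                       (\<forall>\<^sub>F t in at_top. \<not> (\<exists>y\<in>link X t. dist y v < r))"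
begin

text \<open>The lower limit of the links: directions approached at all large scales. By the
  dichotomy it equals the upper limit, the directions approached at arbitrarily large
  scales.\<close>

definition D :: "'a set" where
  "D = {v \<in> sphere 0 1. \<forall>r>0. \<forall>\<^sub>F t in at_top. \<exists>y\<in>link X t. dist y v < r}"

lemma D_sphere: "D \<subseteq> sphere 0 1" by (auto simp: D_def)

lemma D_near: "v \<in> D \<Longrightarrow> r > 0 \<Longrightarrow> \<forall>\<^sub>F t in at_top. \<exists>y\<in>link X t. dist y v < r"
  by (simp add: D_def)

lemma eventually_near_if_sequence:
  assumes "r > 0" "filterlim t at_top sequentially" "\<forall>\<^sub>F j in sequentially. \<exists>y\<in>link X (t j). dist y v < r"
  shows "\<forall>\<^sub>F t in at_top. \<exists>y\<in>link X t. dist y v < r"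
proof (rule ccontr)
  assume "\<not> ?thesis"
  then have "\<forall>\<^sub>F t in at_top. \<not> (\<exists>y\<in>link X t. dist y v < r)" using near_or_far[OF assms(1)] by blast
  with assms(2) have "\<forall>\<^sub>F j in sequentially. \<not> (\<exists>y\<in>link X (t j). dist y v < r)"
    using filterlim_iff by blast
  with assms(3) have "\<forall>\<^sub>F j in sequentially. False" by eventually_elim blast
  then show False by simp
qed

lemma closed_D: "closed D"
proof -
  have "v \<in> D" if v: "v \<in> closure D" for v
  proof -
    have "v \<in> sphere 0 1"
      using v closure_mono[OF D_sphere] by (auto simp: closure_closed)
    moreover have "\<forall>\<^sub>F t in at_top. \<exists>y\<in>link X t. dist y v < r" if r: "r > 0" for r
    proof -
      obtain w where w: "w \<in> D" "dist w v < r / 2" using v half_gt_zero[OF r] unfolding closure_approachable by blast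
      have "\<forall>\<^sub>F t in at_top. \<exists>y\<in>link X t. dist y w < r / 2" by (rule D_near[OF w(1) half_gt_zero[OF r]])
      then show ?thesis
      proof (rule eventually_mono)
        fix t assume "\<exists>y\<in>link X t. dist y w < r / 2"
        then obtain y where y: "y \<in> link X t" "dist y w < r / 2" by blast
        have "dist y v < r" using y(2) w(2) dist_triangle[of y v w] by linarith
        with y show "\<exists>y\<in>link X t. dist y v < r" by blast
      qed
    qed
    ultimately show ?thesis by (simp add: D_def)
  qed
  then show ?thesis by (metis closure_subset closure_eq subset_antisym subsetI)
qed

lemma compact_D: "compact D"
  using closed_D D_sphere by (metis compact_sphere compact_Int_closed inf.absorb_iff2)

lemma eventually_link_nonempty: "\<forall>\<^sub>F t in at_top. link X t \<noteq> {}"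
proof -
  have "\<exists>x\<in>X. norm x > real j" for j
    using unbounded by (meson bounded_iff not_le)
  then obtain x where x: "\<And>j. x j \<in> X" "\<And>j. norm (x j) > real j" by metis
  have "filterlim (\<lambda>j. norm (x j)) at_top sequentially"
    by (rule filterlim_at_top_mono[OF filterlim_real_sequentially]) (use x(2) in \<open>auto intro: less_imp_le always_eventually\<close>)
  \<comment> \<open>The ball of radius 2 about 0 contains the unit sphere, so here the dichotomy is
    applied to mere nonemptiness of the link.\<close>
  moreover have "\<exists>y\<in>link X (norm (x j)). dist y 0 < 2" for j
  proof -
    have "(1 / norm (x j)) *\<^sub>R x j \<in> link X (norm (x j))" using x by (auto simp: link_def)
    moreover have "x j \<noteq> 0" using x(2)[of j] by auto
    then have "norm ((1 / norm (x j)) *\<^sub>R x j) = 1" by simp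
    ultimately show ?thesis by (metis dist_0_norm dist_commute one_less_numeral_iff semiring_norm(76))
  qed
  ultimately have "\<forall>\<^sub>F t in at_top. \<exists>y\<in>link X t. dist y 0 < 2"
    by (intro eventually_near_if_sequence) auto
  then show ?thesis by (auto elim: eventually_mono)
qed

text \<open>By the dichotomy each unit vector outside \<open>D\<close> has a ball that the links
  eventually avoid; compactness of the sphere minus the \<open>e\<close>-neighbourhood of
  \<open>D\<close> makes the scale uniform.\<close>

lemma eventually_link_near_D:
  assumes "e > 0"
  shows "\<forall>\<^sub>F t in at_top. \<forall>y\<in>link X t. \<exists>v\<in>D. dist y v < e"
proof -
  define K where "K = sphere 0 1 - (\<Union>v\<in>D. ball v e)"
  have "compact K" unfolding K_def by (intro compact_diff) auto
  have "\<forall>v\<in>K. \<exists>r>0. \<forall>\<^sub>F t in at_top. \<not> (\<exists>y\<in>link X t. dist y v < r)"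
  proof
    fix v assume "v \<in> K"
    then have "v \<notin> D" "v \<in> sphere 0 1" using assms by (auto simp: K_def)
    then show "\<exists>r>0. \<forall>\<^sub>F t in at_top. \<not> (\<exists>y\<in>link X t. dist y v < r)"
      using near_or_far unfolding D_def by blast
  qed
  from bchoice[OF this] obtain r where r:
    "\<forall>v\<in>K. r v > 0 \<and> (\<forall>\<^sub>F t in at_top. \<not> (\<exists>y\<in>link X t. dist y v < r v))" ..
  have "K \<subseteq> (\<Union>v\<in>K. ball v (r v))" using r by force
  then obtain k where k: "k \<subseteq> K" "finite k" "K \<subseteq> (\<Union>v\<in>k. ball v (r v))"
    using compactE_image[OF \<open>compact K\<close>, of K "\<lambda>v. ball v (r v)"] by auto
  have "\<forall>\<^sub>F t in at_top. \<forall>v\<in>k. \<not> (\<exists>y\<in>link X t. dist y v < r v)"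
    using r k by (intro eventually_ball_finite) auto
  moreover have "\<forall>\<^sub>F t in at_top. t > (0::real)" by (rule eventually_gt_at_top)
  ultimately show ?thesis
  proof eventually_elim
    case (elim t)
    show ?case
    proof (rule ballI, rule ccontr)
      fix y assume y: "y \<in> link X t" "\<not> (\<exists>v\<in>D. dist y v < e)"
      then have "y \<in> K" using norm_link[OF y(1)] elim by (auto simp: K_def dist_commute)
      then show False using k(3) elim(1) y(1) by (force simp: dist_commute)
    qed
  qed
qed

lemma eventually_D_near_link:
  assumes "e > 0"
  shows "\<forall>\<^sub>F t in at_top. \<forall>v\<in>D. \<exists>y\<in>link X t. dist y v < e"
proof -
  obtain k where k: "finite k" "k \<subseteq> D" "D \<subseteq> (\<Union>v\<in>k. ball v (e / 2))"
    using compactE_image[OF compact_D, of D "\<lambda>v. ball v (e / 2)"] assms by force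
  have "\<forall>\<^sub>F t in at_top. \<forall>v\<in>k. \<exists>y\<in>link X t. dist y v < e / 2"
    using k(2) by (intro eventually_ball_finite k(1) ballI D_near half_gt_zero assms) blast
  then show ?thesis
  proof eventually_elim
    case (elim t)
    show ?case
    proof
      fix v assume "v \<in> D"
      then obtain w where w: "w \<in> k" "dist w v < e / 2" using k(3) by auto
      then obtain y where y: "y \<in> link X t" "dist y w < e / 2" using elim by blast
      then have "dist y v < e" using w dist_triangle[of y v w] by linarith
      with y show "\<exists>y\<in>link X t. dist y v < e" by blast
    qed
  qed
qed

lemma D_nonempty: "D \<noteq> {}"
proof -
  have "\<forall>\<^sub>F t in at_top. \<exists>y\<in>link X t. \<exists>v\<in>D. dist y v < 1"
    using eventually_link_near_D[OF zero_less_one] eventually_link_nonempty by eventually_elim blast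
  then have "\<exists>t. \<exists>y\<in>link X t. \<exists>v\<in>D. dist y v < 1"
    using eventually_happens'[OF trivial_limit_at_top_linorder] by blast
  then show ?thesis by blast
qed

lemma hausdorff_converges_link:
  assumes "filterlim t at_top sequentially"
  shows "hausdorff_converges (\<lambda>j. link X (t j)) D"
  unfolding hausdorff_converges_def
proof (intro conjI allI impI closed_D)
  fix e :: real assume "e > 0"
  then have "\<forall>\<^sub>F t in at_top. (\<forall>y\<in>link X t. \<exists>v\<in>D. dist y v < e) \<and> (\<forall>v\<in>D. \<exists>y\<in>link X t. dist y v < e)"
    by (intro eventually_conj eventually_link_near_D eventually_D_near_link)
  with assms show "\<forall>\<^sub>F j in sequentially. (\<forall>y\<in>link X (t j). \<exists>v\<in>D. dist y v < e) \<and> (\<forall>v\<in>D. \<exists>y\<in>link X (t j). dist y v < e)"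
    using filterlim_iff by blast
qed

text \<open>One inclusion passes from a sequence of scales to all scales; the other relies on the
  limit being closed, without which it would be determined only up to closure.\<close>

lemma hausdorff_limit_unique:
  assumes t: "filterlim t at_top sequentially" and D': "D' \<subseteq> sphere 0 1"
    and lim: "hausdorff_converges (\<lambda>j. link X (t j)) D'"
  shows "D' = D"
proof
  note lim' = lim[unfolded hausdorff_converges_def]
  show "D' \<subseteq> D"
  proof
    fix v assume v: "v \<in> D'"
    have "\<forall>\<^sub>F t in at_top. \<exists>y\<in>link X t. dist y v < r" if "r > 0" for r
    proof (rule eventually_near_if_sequence[OF that t])
      have "\<forall>\<^sub>F j in sequentially. \<forall>v\<in>D'. \<exists>y\<in>link X (t j). dist y v < r"
        using conjunct2[OF lim', rule_format, OF that] by eventually_elim blast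
      then show "\<forall>\<^sub>F j in sequentially. \<exists>y\<in>link X (t j). dist y v < r"
        by eventually_elim (use v in blast)
    qed
    with v D' show "v \<in> D" by (auto simp: D_def)
  qed
  show "D \<subseteq> D'"
  proof
    fix v assume v: "v \<in> D"
    have "\<exists>w\<in>D'. dist w v < e" if "e > 0" for e
    proof -
      have "\<forall>\<^sub>F t in at_top. \<exists>y\<in>link X t. dist y v < e / 2" by (rule D_near[OF v half_gt_zero[OF that]])
      with t have 1: "\<forall>\<^sub>F j in sequentially. \<exists>y\<in>link X (t j). dist y v < e / 2"
        using filterlim_iff by blast
      have 2: "\<forall>\<^sub>F j in sequentially. \<forall>y\<in>link X (t j). \<exists>w\<in>D'. dist y w < e / 2"
        using conjunct2[OF lim', rule_format, OF half_gt_zero[OF that]] by eventually_elim blast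
      have "\<exists>j. (\<exists>y\<in>link X (t j). dist y v < e / 2) \<and> (\<forall>y\<in>link X (t j). \<exists>w\<in>D'. dist y w < e / 2)"
        using eventually_happens'[OF _ eventually_conj[OF 1 2]] by simp
      then obtain y w where "dist y v < e / 2" "w \<in> D'" "dist y w < e / 2" by blast
      then show ?thesis using dist_triangle3[of w v y] by (intro bexI[of _ w]) (auto simp: dist_commute)
    qed
    then have "v \<in> closure D'" by (simp add: closure_approachable)
    then show "v \<in> D'" using lim' by simp
  qed
qed

lemma C_infinity_eq: "C_infinity X = {s *\<^sub>R v | s v. v \<in> D \<and> s \<ge> 0}"
  unfolding C_infinity_def
proof (rule the_equality)
  have "filterlim (\<lambda>j. real (Suc j)) at_top sequentially"
    by (rule filterlim_compose[OF filterlim_real_sequentially filterlim_Suc])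
  then show "is_tangent_cone_at_infinity X {s *\<^sub>R v | s v. v \<in> D \<and> s \<ge> 0}"
    unfolding is_tangent_cone_at_infinity_def link_def[symmetric]
    by (intro exI[of _ "\<lambda>j. real (Suc j)"] exI[of _ D] conjI hausdorff_converges_link D_sphere) auto
  show "E = {s *\<^sub>R v | s v. v \<in> D \<and> s \<ge> 0}" if "is_tangent_cone_at_infinity X E" for E
    using that hausdorff_limit_unique unfolding is_tangent_cone_at_infinity_def link_def[symmetric] by blast
qed

text \<open>For \<open>w = s *\<^sub>R v\<close> the link is taken at scale \<open>s * t\<close>:
  dividing its points by \<open>t\<close> instead gives norm \<open>s\<close>, and an error
  \<open>e / s\<close> in direction becomes \<open>e\<close>.\<close>

lemma eventually_approx_C_infinity:
  assumes w: "w \<in> C_infinity X" "w \<noteq> 0" and "e > 0"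
  shows "\<forall>\<^sub>F t in at_top. \<exists>x\<in>X. dist ((1 / t) *\<^sub>R x) w < e"
proof -
  obtain s v where sv: "w = s *\<^sub>R v" "v \<in> D" "s \<ge> 0" using w(1) by (auto simp: C_infinity_eq)
  then have "s > 0" using w(2) by (cases "s = 0") auto
  have "\<forall>\<^sub>F t in at_top. \<exists>y\<in>link X t. dist y v < e / s"
    using sv \<open>s > 0\<close> \<open>e > 0\<close> by (intro D_near) auto
  moreover have "filterlim (\<lambda>t. s * t) at_top at_top"
    using \<open>s > 0\<close> by (intro filterlim_tendsto_pos_mult_at_top[OF tendsto_const] filterlim_ident)
  ultimately have "\<forall>\<^sub>F t in at_top. \<exists>y\<in>link X (s * t). dist y v < e / s"
    using filterlim_iff by fast
  moreover have "\<forall>\<^sub>F t in at_top. t > (0::real)" by (rule eventually_gt_at_top)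
  ultimately show ?thesis
  proof eventually_elim
    case (elim t)
    then obtain x where x: "x \<in> X" "dist ((1 / (s * t)) *\<^sub>R x) v < e / s" by (auto simp: link_def)
    have "(1 / t) *\<^sub>R x - w = s *\<^sub>R ((1 / (s * t)) *\<^sub>R x - v)"
      using \<open>s > 0\<close> elim(2) sv(1) by (simp add: scaleR_diff_right)
    then have "dist ((1 / t) *\<^sub>R x) w = s * dist ((1 / (s * t)) *\<^sub>R x) v"
      using \<open>s > 0\<close> by (simp add: dist_norm)
    also have "\<dots> < e" using x(2) \<open>s > 0\<close> by (simp add: field_simps)
    finally show ?case using x by blast
  qed
qed

lemma eventually_approx_C_infinity_outside_compact:
  assumes "compact K" and w: "w \<in> C_infinity X" and "e > 0"
  shows "\<forall>\<^sub>F t in at_top. \<exists>x\<in>X - K. dist ((1 / t) *\<^sub>R x) w < e"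
proof (cases "w = 0")
  case True
  \<comment> \<open>At the apex one fixed point outside \<open>K\<close> serves all large
    scales.\<close>
  have "X - K \<noteq> {}"
    using unbounded compact_imp_bounded[OF assms(1)] bounded_subset[of K X] by blast
  then obtain x where x: "x \<in> X - K" by blast
  have "((\<lambda>t::real. inverse t *\<^sub>R x) \<longlongrightarrow> 0 *\<^sub>R x) at_top"
    by (intro tendsto_scaleR tendsto_const tendsto_inverse_0_at_top filterlim_ident)
  from tendstoD[OF this \<open>e > 0\<close>] have "\<forall>\<^sub>F t in at_top. dist ((1 / t) *\<^sub>R x) w < e"
    using True by (simp add: inverse_eq_divide)
  then show ?thesis by eventually_elim (use x in blast)
next
  case False
  obtain R where R: "\<And>x. x \<in> K \<Longrightarrow> norm x \<le> R"
    using compact_imp_bounded[OF assms(1)] by (auto simp: bounded_iff)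
  \<comment> \<open>A rescaled point closer to \<open>w\<close> than \<open>norm w / 2\<close> has
    norm above \<open>norm w / 2\<close>, so the point itself lies outside the ball containing
    \<open>K\<close> once \<open>t\<close> is large.\<close>
  have "min e (norm w / 2) > 0" using False \<open>e > 0\<close> by simp
  from eventually_approx_C_infinity[OF w False this]
  have "\<forall>\<^sub>F t in at_top. \<exists>x\<in>X. dist ((1 / t) *\<^sub>R x) w < min e (norm w / 2)" .
  moreover have "\<forall>\<^sub>F t in at_top. t > (0::real)" by (rule eventually_gt_at_top)
  moreover have "\<forall>\<^sub>F t in at_top. t > R / (norm w / 2)" by (rule eventually_gt_at_top)
  ultimately show ?thesis
  proof eventually_elim
    case (elim t)
    then obtain x where x: "x \<in> X" "dist ((1 / t) *\<^sub>R x) w < e" "dist ((1 / t) *\<^sub>R x) w < norm w / 2" by auto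
    have "norm w \<le> norm ((1 / t) *\<^sub>R x) + dist ((1 / t) *\<^sub>R x) w"
      by (metis add.commute dist_commute dist_norm norm_triangle_sub)
    moreover have "norm ((1 / t) *\<^sub>R x) = norm x / t" using elim(2) by simp
    ultimately have "norm w / 2 < norm x / t" using x(3) by linarith
    then have "t * (norm w / 2) < norm x" using elim(2) by (simp add: field_simps)
    moreover have "R < t * (norm w / 2)" using elim(3) False by (simp add: field_simps)
    ultimately have "x \<notin> K" using R[of x] by force
    with x show ?case by blast
  qed
qed

text \<open>For nonzero \<open>w\<close> the norms of \<open>x j\<close> tend to infinity and
  replace \<open>t j\<close> as scales: the normalised points lie exactly in the links there and
  converge to the direction of \<open>w\<close>.\<close>

lemma limit_in_C_infinity:
  assumes t: "filterlim t at_top sequentially" and x: "\<And>j. x j \<in> X"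
    and lim: "(\<lambda>j. (1 / t j) *\<^sub>R x j) \<longlonglongrightarrow> w"
  shows "w \<in> C_infinity X"
proof (cases "w = 0")
  case True
  then show ?thesis using D_nonempty by (force simp: C_infinity_eq)
next
  case False
  have tpos: "\<forall>\<^sub>F j in sequentially. t j > 0" using t filterlim_at_top_dense by blast
  have nlim: "(\<lambda>j. norm ((1 / t j) *\<^sub>R x j)) \<longlonglongrightarrow> norm w" by (intro tendsto_norm lim)
  then have "filterlim (\<lambda>j. norm ((1 / t j) *\<^sub>R x j) * t j) at_top sequentially"
    using False t by (intro filterlim_tendsto_pos_mult_at_top) auto
  moreover have "\<forall>\<^sub>F j in sequentially. norm ((1 / t j) *\<^sub>R x j) * t j = norm (x j)"
    using tpos by eventually_elim simp
  ultimately have n: "filterlim (\<lambda>j. norm (x j)) at_top sequentially"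
    by (simp cong: filterlim_cong)
  have "(\<lambda>j. (1 / norm ((1 / t j) *\<^sub>R x j)) *\<^sub>R ((1 / t j) *\<^sub>R x j)) \<longlonglongrightarrow> (1 / norm w) *\<^sub>R w"
    using False by (intro tendsto_intros lim nlim) auto
  moreover have "\<forall>\<^sub>F j in sequentially. (1 / norm ((1 / t j) *\<^sub>R x j)) *\<^sub>R ((1 / t j) *\<^sub>R x j) = (1 / norm (x j)) *\<^sub>R x j"
    using tpos by eventually_elim simp
  ultimately have lim': "(\<lambda>j. (1 / norm (x j)) *\<^sub>R x j) \<longlonglongrightarrow> (1 / norm w) *\<^sub>R w"
    by (rule Lim_transform_eventually)
  have "\<forall>\<^sub>F t in at_top. \<exists>y\<in>link X t. dist y ((1 / norm w) *\<^sub>R w) < r" if "r > 0" for r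
  proof (rule eventually_near_if_sequence[OF that n])
    show "\<forall>\<^sub>F j in sequentially. \<exists>y\<in>link X (norm (x j)). dist y ((1 / norm w) *\<^sub>R w) < r"
      using tendstoD[OF lim' that] by eventually_elim (use x in \<open>auto simp: link_def\<close>)
  qed
  then have "(1 / norm w) *\<^sub>R w \<in> D" using False by (simp add: D_def)
  moreover have "w = norm w *\<^sub>R ((1 / norm w) *\<^sub>R w)" using False by simp
  ultimately show ?thesis unfolding C_infinity_eq using norm_ge_zero[of w] by blast
qed

end

section \<open>Semialgebraic sets described by signs of polynomials\<close>

lemma poly_fun_poly_in:
  fixes p :: "real ^ 'm \<Rightarrow> real"
  shows "p \<in> poly_fun \<Longrightarrow> (\<lambda>d::'m option \<Rightarrow> real. p (\<chi> i. d (Some i))) \<in> poly_in UNIV"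
  by (induction rule: poly_fun.induct) (auto intro: poly_in.intros)

lemma semialgebraic_determined_by_signs:
  fixes A :: "(real ^ 'm) set"
  assumes "A \<in> semialgebraic"
  shows "\<exists>F. finite F \<and> F \<subseteq> poly_in UNIV \<and>
    (\<forall>d d' :: 'm option \<Rightarrow> real. same_signs F d d' \<longrightarrow> ((\<chi> i. d (Some i)) \<in> A \<longleftrightarrow> (\<chi> i. d' (Some i)) \<in> A))"
  using assms
proof (induction rule: semialgebraic.induct)
  case (sa_zero p)
  show ?case
    using poly_fun_poly_in[OF sa_zero] 
    by (intro exI[of _ "{\<lambda>d. p (\<chi> i. d (Some i))}"]) (auto simp: same_signs_def sgn_if split: if_splits)
next
  case (sa_pos p)
  show ?case
    using poly_fun_poly_in[OF sa_pos] 
    by (intro exI[of _ "{\<lambda>d. p (\<chi> i. d (Some i))}"]) (auto simp: same_signs_def sgn_if split: if_splits)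
next
  case (sa_compl S)
  then show ?case by simp
next
  case (sa_union S T)
  then obtain F G where FG: "finite F" "F \<subseteq> poly_in UNIV" "finite G" "G \<subseteq> poly_in UNIV"
    and S: "\<forall>d d' :: 'm option \<Rightarrow> real. same_signs F d d' \<longrightarrow> ((\<chi> i. d (Some i)) \<in> S \<longleftrightarrow> (\<chi> i. d' (Some i)) \<in> S)"
    and T: "\<forall>d d' :: 'm option \<Rightarrow> real. same_signs G d d' \<longrightarrow> ((\<chi> i. d (Some i)) \<in> T \<longleftrightarrow> (\<chi> i. d' (Some i)) \<in> T)"
    by (elim exE conjE)
  have "((\<chi> i. d (Some i)) \<in> S \<longleftrightarrow> (\<chi> i. d' (Some i)) \<in> S) \<and> ((\<chi> i. d (Some i)) \<in> T \<longleftrightarrow> (\<chi> i. d' (Some i)) \<in> T)"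
    if "same_signs (F \<union> G) d d'" for d d' :: "'m option \<Rightarrow> real"
  proof -
    have "same_signs F d d'" "same_signs G d d'" using that by (simp_all add: same_signs_def)
    then show ?thesis
      using S[THEN spec, THEN spec, THEN mp, of d d'] T[THEN spec, THEN spec, THEN mp, of d d'] by blast
  qed
  then show ?case
    using FG by (intro exI[of _ "F \<union> G"] conjI allI impI) (simp_all only: finite_Un Un_subset_iff Un_iff Int_iff simp_thms)
next
  case (sa_inter S T)
  then obtain F G where FG: "finite F" "F \<subseteq> poly_in UNIV" "finite G" "G \<subseteq> poly_in UNIV"
    and S: "\<forall>d d' :: 'm option \<Rightarrow> real. same_signs F d d' \<longrightarrow> ((\<chi> i. d (Some i)) \<in> S \<longleftrightarrow> (\<chi> i. d' (Some i)) \<in> S)"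
    and T: "\<forall>d d' :: 'm option \<Rightarrow> real. same_signs G d d' \<longrightarrow> ((\<chi> i. d (Some i)) \<in> T \<longleftrightarrow> (\<chi> i. d' (Some i)) \<in> T)"
    by (elim exE conjE)
  have "((\<chi> i. d (Some i)) \<in> S \<longleftrightarrow> (\<chi> i. d' (Some i)) \<in> S) \<and> ((\<chi> i. d (Some i)) \<in> T \<longleftrightarrow> (\<chi> i. d' (Some i)) \<in> T)"
    if "same_signs (F \<union> G) d d'" for d d' :: "'m option \<Rightarrow> real"
  proof -
    have "same_signs F d d'" "same_signs G d d'" using that by (simp_all add: same_signs_def)
    then show ?thesis
      using S[THEN spec, THEN spec, THEN mp, of d d'] T[THEN spec, THEN spec, THEN mp, of d d'] by blast
  qed
  then show ?case
    using FG by (intro exI[of _ "F \<union> G"] conjI allI impI) (simp_all only: finite_Un Un_subset_iff Un_iff Int_iff simp_thms)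
qed

text \<open>A point x and a scale t are encoded as one assignment, with t at \<open>None\<close>.\<close>

lemma semialgebraic_conic_at_infinity:
  fixes A :: "(real ^ 'm) set"
  assumes "A \<in> semialgebraic" "\<not> bounded A"
  shows "conic_at_infinity A"
proof
  fix v :: "real ^ 'm" and r :: real assume "r > 0"
  obtain F where F: "finite F" "F \<subseteq> poly_in UNIV" "\<forall>d d' :: 'm option \<Rightarrow> real. same_signs F d d' \<longrightarrow>
      ((\<chi> i. d (Some i)) \<in> A \<longleftrightarrow> (\<chi> i. d' (Some i)) \<in> A)"
    using semialgebraic_determined_by_signs[OF assms(1)] by (elim exE conjE)
  \<comment> \<open>Denominators are cleared: for a positive scale t, \<open>f1 d = 0\<close> says
    that x has norm t, and \<open>f2 d < 0\<close> that x - t v has norm less than t r, so that x /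
    t is within \<open>r\<close> of \<open>v\<close>.\<close>
  define f1 where "f1 d = (\<Sum>i\<in>UNIV. d (Some i) * d (Some i)) - d None * d None" for d :: "'m option \<Rightarrow> real"
  define f2 where "f2 d = (\<Sum>i\<in>UNIV. (d (Some i) - d None * v $ i) * (d (Some i) - d None * v $ i)) - (d None * r) * (d None * r)"
    for d :: "'m option \<Rightarrow> real"
  have f: "f1 \<in> poly_in UNIV" "f2 \<in> poly_in UNIV"
    unfolding f1_def[abs_def] f2_def[abs_def]
    by (intro poly_in_diff poly_in_sum poly_in.mult poly_in.var poly_in.const UNIV_I)+
  define Q where "Q d \<longleftrightarrow> (\<chi> i. d (Some i)) \<in> A \<and> f1 d = 0 \<and> f2 d < 0" for d :: "'m option \<Rightarrow> real"
  have f1_iff: "f1 d = 0 \<longleftrightarrow> norm (\<chi> i. d (Some i)) = d None" if "d None > 0" for d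
  proof -
    have "f1 d = (norm (\<chi> i. d (Some i)))\<^sup>2 - (d None)\<^sup>2"
      by (simp only: f1_def power2_norm_eq_inner inner_vec_def power2_eq_square[of "d None"]) simp
    then show ?thesis using that by (simp add: power2_eq_iff_nonneg)
  qed
  have f2_iff: "f2 d < 0 \<longleftrightarrow> dist ((1 / d None) *\<^sub>R (\<chi> i. d (Some i))) v < r" if "d None > 0" for d
  proof -
    let ?x = "\<chi> i. d (Some i)"
    have "f2 d = (norm (?x - d None *\<^sub>R v))\<^sup>2 - (d None * r)\<^sup>2"
      by (simp only: f2_def power2_norm_eq_inner inner_vec_def power2_eq_square[of "d None * r"]) simp
    then have "f2 d < 0 \<longleftrightarrow> norm (?x - d None *\<^sub>R v) < d None * r"
      using that \<open>r > 0\<close> by (simp add: power_mono_iff flip: not_le)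
    moreover have "?x - d None *\<^sub>R v = d None *\<^sub>R ((1 / d None) *\<^sub>R ?x - v)"
      using that by (simp add: scaleR_diff_right)
    then have "norm (?x - d None *\<^sub>R v) = d None * dist ((1 / d None) *\<^sub>R ?x) v"
      using that by (simp add: dist_norm)
    ultimately show ?thesis using that by simp
  qed
  have Q_iff: "(\<exists>d. d None = t \<and> Q d) \<longleftrightarrow> (\<exists>y\<in>link A t. dist y v < r)" if "t > 0" for t
  proof
    assume "\<exists>d. d None = t \<and> Q d"
    then obtain d where "d None = t" "Q d" by blast
    then show "\<exists>y\<in>link A t. dist y v < r"
      using that f1_iff[of d] f2_iff[of d] by (auto simp: link_def Q_def)
  next
    assume "\<exists>y\<in>link A t. dist y v < r"
    then obtain x where "x \<in> A" "norm x = t" "dist ((1 / t) *\<^sub>R x) v < r" by (auto simp: link_def)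
    then show "\<exists>d. d None = t \<and> Q d"
      using that f1_iff[of "case_option t (($) x)"] f2_iff[of "case_option t (($) x)"]
      by (intro exI[of _ "case_option t (($) x)"]) (auto simp: Q_def)
  qed
  have "Q d'" if "same_signs (F \<union> {f1, f2}) d d'" "Q d" for d d'
  proof -
    have s: "same_signs F d d'" "sgn (f1 d) = sgn (f1 d')" "sgn (f2 d) = sgn (f2 d')"
      using that(1) by (simp_all add: same_signs_def)
    have "(\<chi> i. d (Some i)) \<in> A \<longleftrightarrow> (\<chi> i. d' (Some i)) \<in> A"
      using F(3)[THEN spec, THEN spec, THEN mp, OF s(1)] .
    moreover have "f1 d = 0 \<longleftrightarrow> f1 d' = 0" using s(2) by (metis sgn_0_0)
    moreover have "f2 d < 0 \<longleftrightarrow> f2 d' < 0" using s(3) by (metis sgn_less)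
    ultimately show ?thesis using that(2) by (simp only: Q_def)
  qed
  then have "(\<forall>\<^sub>F t in at_top. \<exists>d. d None = t \<and> Q d) \<or> (\<forall>\<^sub>F t in at_top. \<not> (\<exists>d. d None = t \<and> Q d))"
    using F f by (intro projection_eventually_const[of "F \<union> {f1, f2}"]) auto
  moreover have pos: "\<forall>\<^sub>F t in at_top. t > (0::real)" by (rule eventually_gt_at_top)
  then have "\<forall>\<^sub>F t in at_top. (\<exists>d. d None = t \<and> Q d) = (\<exists>y\<in>link A t. dist y v < r)"
    by eventually_elim (rule Q_iff)
  then have "eventually (\<lambda>t. \<exists>d. d None = t \<and> Q d) at_top = eventually (\<lambda>t. \<exists>y\<in>link A t. dist y v < r) at_top"
    "eventually (\<lambda>t. \<not> (\<exists>d. d None = t \<and> Q d)) at_top = eventually (\<lambda>t. \<not> (\<exists>y\<in>link A t. dist y v < r)) at_top"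
    by (rule eventually_cong, simp only:)+
  ultimately show "(\<forall>\<^sub>F t in at_top. \<exists>y\<in>link A t. dist y v < r) \<or> (\<forall>\<^sub>F t in at_top. \<not> (\<exists>y\<in>link A t. dist y v < r))"
    by (simp only:)
qed (rule assms)

section \<open>Blowing down a bi-Lipschitz map\<close>

text \<open>Choosing \<open>x n\<close> within 1 / (n + 1) of the infimum of \<open>P n\<close>
  gives one sequence that works for all \<open>e\<close> at once.\<close>

lemma sequence_if_eventually_small:
  fixes P :: "nat \<Rightarrow> 'a \<Rightarrow> real"
  assumes nonneg: "\<And>n x. P n x \<ge> 0" and "X \<noteq> {}"
    and small: "\<And>e. e > 0 \<Longrightarrow> \<forall>\<^sub>F n in sequentially. \<exists>x\<in>X. P n x < e"
  shows "\<exists>x. (\<forall>n. x n \<in> X) \<and> (\<lambda>n. P n (x n)) \<longlonglongrightarrow> 0"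
proof -
  have bdd: "bdd_below (P n ` X)" for n using nonneg by (intro bdd_belowI[of _ 0]) auto
  have "\<forall>n. \<exists>x\<in>X. P n x < (INF x\<in>X. P n x) + 1 / real (Suc n)"
    using cINF_less_iff[OF \<open>X \<noteq> {}\<close> bdd] by (metis less_add_same_cancel1 of_nat_0_less_iff zero_less_Suc zero_less_divide_1_iff)
  then obtain x where x: "\<And>n. x n \<in> X" "\<And>n. P n (x n) < (INF x\<in>X. P n x) + 1 / real (Suc n)" by metis
  have "(\<lambda>n. P n (x n)) \<longlonglongrightarrow> 0"
  proof (rule tendstoI)
    fix e :: real assume "e > 0"
    have "(\<lambda>n. 1 / real (Suc n)) \<longlonglongrightarrow> 0" using LIMSEQ_inverse_real_of_nat by (simp add: inverse_eq_divide)
    from order_tendstoD(2)[OF this half_gt_zero[OF \<open>e > 0\<close>]]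
    have "\<forall>\<^sub>F n in sequentially. 1 / real (Suc n) < e / 2" .
    moreover have "\<forall>\<^sub>F n in sequentially. \<exists>x\<in>X. P n x < e / 2" by (rule small[OF half_gt_zero[OF \<open>e > 0\<close>]])
    ultimately show "\<forall>\<^sub>F n in sequentially. dist (P n (x n)) 0 < e"
    proof eventually_elim
      case (elim n)
      then have "(INF x\<in>X. P n x) < e / 2" using cINF_less_iff[OF \<open>X \<noteq> {}\<close> bdd] by blast
      then show ?case using x(2)[of n] elim(1) nonneg[of n "x n"] by simp
    qed
  qed
  with x(1) show ?thesis by blast
qed

text \<open>The bounds depend on \<open>w\<close>; dividing by them gives functions bounded by 1, to
  which the diagonal argument applies, and multiplying by the fixed \<open>M w\<close> restores the
  limits.\<close>

lemma convergent_subsequence_on_countable: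
  fixes F :: "nat \<Rightarrow> 'a \<Rightarrow> 'b::euclidean_space"
  assumes "countable S" and bdd: "\<And>w. w \<in> S \<Longrightarrow> Bseq (\<lambda>n. F n w)"
  obtains k :: "nat \<Rightarrow> nat" where "strict_mono k" "\<And>w. w \<in> S \<Longrightarrow> convergent (\<lambda>n. F (k n) w)"
proof -
  have "\<forall>w\<in>S. \<exists>M>0. \<forall>n. norm (F n w) \<le> M" using bdd by (auto simp: Bseq_def)
  from bchoice[OF this] obtain M where M: "\<And>w. w \<in> S \<Longrightarrow> M w > 0" "\<And>w n. w \<in> S \<Longrightarrow> norm (F n w) \<le> M w"
    by blast
  have "norm (F n w /\<^sub>R M w) \<le> 1" if "w \<in> S" for n w
    using M(1)[OF that] M(2)[OF that, of n] by (simp add: field_simps)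
  then obtain k where k: "strict_mono (k::nat\<Rightarrow>nat)" "\<And>w. w \<in> S \<Longrightarrow> \<exists>l. (\<lambda>n. F (k n) w /\<^sub>R M w) \<longlonglongrightarrow> l"
    using function_convergent_subsequence[OF assms(1), of "\<lambda>n w. F n w /\<^sub>R M w" 1] by blast
  have "convergent (\<lambda>n. F (k n) w)" if "w \<in> S" for w
  proof -
    obtain l where "(\<lambda>n. F (k n) w /\<^sub>R M w) \<longlonglongrightarrow> l" using k(2)[OF \<open>w \<in> S\<close>] by blast
    from tendsto_scaleR[OF tendsto_const[of "M w"] this] show ?thesis
      using M(1)[OF \<open>w \<in> S\<close>] by (auto simp: convergent_def)
  qed
  with k(1) show thesis by (rule that)
qed

lemma bilipschitz_homeomorphicI:
  fixes h :: "'a::metric_space \<Rightarrow> 'b::metric_space"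
  assumes surj: "h ` S = T" and "L \<ge> 0" "L' \<ge> 0"
    and up: "\<And>x y. x \<in> S \<Longrightarrow> y \<in> S \<Longrightarrow> dist (h x) (h y) \<le> L * dist x y"
    and low: "\<And>x y. x \<in> S \<Longrightarrow> y \<in> S \<Longrightarrow> dist x y \<le> L' * dist (h x) (h y)"
  shows "bilipschitz_homeomorphic S T"
proof -
  define g where "g = inv_into S h"
  have "inj_on h S"
  proof (rule inj_onI)
    fix x y assume "x \<in> S" "y \<in> S" "h x = h y"
    then show "x = y" using low[of x y] by simp
  qed
  have gh: "g (h x) = x" if "x \<in> S" for x using that \<open>inj_on h S\<close> by (simp add: g_def)
  have hg: "h (g y) = y" "g y \<in> S" if "y \<in> T" for y
    using that surj by (auto simp: g_def f_inv_into_f inv_into_into)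
  have lip: "L-lipschitz_on S h" using up \<open>L \<ge> 0\<close> by (intro lipschitz_onI)
  have lip': "L'-lipschitz_on T g"
    using low[OF hg(2) hg(2)] \<open>L' \<ge> 0\<close> by (intro lipschitz_onI) (auto simp: hg)
  have "homeomorphism S T h g"
    unfolding homeomorphism_def
  proof (intro conjI ballI)
    show "g ` T = S" using surj gh by (force simp: image_image)
  qed (use surj gh hg lipschitz_on_continuous_on[OF lip] lipschitz_on_continuous_on[OF lip'] in auto)
  with lip lip' show ?thesis unfolding bilipschitz_homeomorphic_def by blast
qed

lemma filterlim_real_Suc: "filterlim (\<lambda>n. real (Suc n)) at_top sequentially"
  by (rule filterlim_compose[OF filterlim_real_sequentially filterlim_Suc])

lemma rescaled_sequence_tendsto:
  fixes w :: "'a::real_normed_vector"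
  assumes "Z \<noteq> {}" and *: "\<And>e. e > 0 \<Longrightarrow> \<forall>\<^sub>F t in at_top. \<exists>x\<in>Z. dist ((1 / t) *\<^sub>R x) w < e"
  shows "\<exists>z. (\<forall>n. z n \<in> Z) \<and> (\<lambda>n. (1 / real (Suc n)) *\<^sub>R z n) \<longlonglongrightarrow> w"
proof -
  have "\<forall>\<^sub>F n in sequentially. \<exists>x\<in>Z. dist ((1 / real (Suc n)) *\<^sub>R x) w < e" if "e > 0" for e
    by (rule eventually_compose_filterlim[OF *[OF that] filterlim_real_Suc])
  from sequence_if_eventually_small[of "\<lambda>n x. dist ((1 / real (Suc n)) *\<^sub>R x) w", OF zero_le_dist \<open>Z \<noteq> {}\<close> this]
  show ?thesis by (simp only: tendsto_dist_iff[of "\<lambda>n. (1 / real (Suc n)) *\<^sub>R z n" for z])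
qed

lemma dist_scaleR_pos:
  fixes a b :: "'a::real_normed_vector"
  shows "c > 0 \<Longrightarrow> dist (c *\<^sub>R a) (c *\<^sub>R b) = c * dist a b"
  by (simp add: dist_norm flip: scaleR_diff_right)

text \<open>The bi-Lipschitz map of the cones is a subsequential limit of the rescaled maps
  \<open>w \<mapsto> f (n w) / n\<close>, evaluated at points of X close to \<open>n w\<close>.\<close>

lemma bilipschitz_homeomorphic_blow_down:
  fixes X CX :: "'a::euclidean_space set" and Y CY :: "'b::euclidean_space set"
  assumes "X \<noteq> {}"
    and approxX: "\<And>w e. w \<in> CX \<Longrightarrow> e > 0 \<Longrightarrow> \<forall>\<^sub>F t in at_top. \<exists>x\<in>X. dist ((1 / t) *\<^sub>R x) w < e"
    and limX: "\<And>t x w. filterlim t at_top sequentially \<Longrightarrow> (\<And>j. x j \<in> X) \<Longrightarrow> (\<lambda>j. (1 / t j) *\<^sub>R x j) \<longlonglongrightarrow> w \<Longrightarrow> w \<in> CX"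
    and approxY: "\<And>w e. w \<in> CY \<Longrightarrow> e > 0 \<Longrightarrow> \<forall>\<^sub>F t in at_top. \<exists>y\<in>Y. dist ((1 / t) *\<^sub>R y) w < e"
    and limY: "\<And>t y w. filterlim t at_top sequentially \<Longrightarrow> (\<And>j. y j \<in> Y) \<Longrightarrow> (\<lambda>j. (1 / t j) *\<^sub>R y j) \<longlonglongrightarrow> w \<Longrightarrow> w \<in> CY"
    and bilip: "bilipschitz_homeomorphic X Y"
  shows "bilipschitz_homeomorphic CX CY"
proof -
  obtain f g L L' where hom: "homeomorphism X Y f g" and lf: "L-lipschitz_on X f" and lg: "L'-lipschitz_on Y g"
    using bilip unfolding bilipschitz_homeomorphic_def by blast
  have L: "L \<ge> 0" "L' \<ge> 0" using lf lg by (auto dest: lipschitz_on_nonneg)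
  have fY: "f x \<in> Y" "g (f x) = x" if "x \<in> X" for x using hom that by (auto simp: homeomorphism_def)
  have gX: "g y \<in> X" "f (g y) = y" if "y \<in> Y" for y using hom that by (auto simp: homeomorphism_def)
  \<comment> \<open>The scales start at 1, so every \<open>c n\<close> is positive. Rescaling source
    and target by the same factor preserves both Lipschitz constants.\<close>
  define c where "c n = 1 / real (Suc n)" for n
  have c: "c n > 0" for n by (simp add: c_def)
  have c0: "c \<longlonglongrightarrow> 0"
    using LIMSEQ_inverse_real_of_nat unfolding c_def[abs_def] by (simp add: inverse_eq_divide)
  have F_le: "dist (c n *\<^sub>R f a) (c n *\<^sub>R f b) \<le> L * dist (c n *\<^sub>R a) (c n *\<^sub>R b)"
      if "a \<in> X" "b \<in> X" for n a b
    using mult_left_mono[OF lipschitz_onD[OF lf that] less_imp_le[OF c[of n]]]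
    by (simp add: dist_scaleR_pos[OF c] mult_ac)
  have F_ge: "dist (c n *\<^sub>R a) (c n *\<^sub>R b) \<le> L' * dist (c n *\<^sub>R f a) (c n *\<^sub>R f b)"
      if "a \<in> X" "b \<in> X" for n a b
    using mult_left_mono[OF lipschitz_onD[OF lg fY(1)[OF that(1)] fY(1)[OF that(2)]] less_imp_le[OF c[of n]]]
    by (simp add: dist_scaleR_pos[OF c] mult_ac fY(2) that)
  have "\<forall>w\<in>CX. \<exists>x. (\<forall>n. x n \<in> X) \<and> (\<lambda>n. c n *\<^sub>R x n) \<longlonglongrightarrow> w"
    unfolding c_def by (intro ballI rescaled_sequence_tendsto approxX \<open>X \<noteq> {}\<close>)
  from bchoice[OF this] obtain x where
    x': "\<forall>w\<in>CX. (\<forall>n. x w n \<in> X) \<and> (\<lambda>n. c n *\<^sub>R x w n) \<longlonglongrightarrow> w" ..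
  have x: "x w n \<in> X" "(\<lambda>n. c n *\<^sub>R x w n) \<longlonglongrightarrow> w" if "w \<in> CX" for w n
    using bspec[OF x' that] by simp_all
  define F where "F n w = c n *\<^sub>R f (x w n)" for n w
  have dist_x: "(\<lambda>n. dist (c n *\<^sub>R x w n) (c n *\<^sub>R x w' n)) \<longlonglongrightarrow> dist w w'" if "w \<in> CX" "w' \<in> CX" for w w'
    by (intro tendsto_dist x that)
  obtain x0 where x0: "x0 \<in> X" using \<open>X \<noteq> {}\<close> by blast
  \<comment> \<open>Values are compared with the image of a fixed point \<open>x0\<close>, which
    shrinks to 0 under rescaling.\<close>
  have bounded_F: "Bseq (\<lambda>n. F n w)" if w: "w \<in> CX" for w
  proof -
    define B where "B n = L * dist (c n *\<^sub>R x w n) (c n *\<^sub>R x0) + norm (c n *\<^sub>R f x0)" for n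
    have "B \<longlonglongrightarrow> L * dist w (0 *\<^sub>R x0) + norm (0 *\<^sub>R f x0)"
      unfolding B_def[abs_def] by (intro tendsto_intros x w c0)
    then have "Bseq B" using convergent_imp_Bseq convergentI by blast
    moreover have "norm (F n w) \<le> norm (B n)" for n
    proof -
      have "norm (F n w) \<le> dist (F n w) (c n *\<^sub>R f x0) + norm (c n *\<^sub>R f x0)"
        using norm_triangle_ineq[of "F n w - c n *\<^sub>R f x0" "c n *\<^sub>R f x0"] by (simp add: dist_norm)
      also have "\<dots> \<le> B n" using F_le[OF x(1)[OF w] x0, of n n] by (simp add: B_def F_def)
      finally show ?thesis by simp
    qed
    then have "\<forall>\<^sub>F n in sequentially. norm (F n w) \<le> norm (B n)" by simp
    ultimately show ?thesis by (rule Bseq_eventually_mono[rotated])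
  qed
  obtain S where S: "countable S" "S \<subseteq> CX" "CX \<subseteq> closure S" using separable by blast
  obtain k :: "nat \<Rightarrow> nat" where k: "strict_mono k" "\<And>w. w \<in> S \<Longrightarrow> convergent (\<lambda>n. F (k n) w)"
    using convergent_subsequence_on_countable[OF S(1), of F] bounded_F S(2) by blast
  have conv: "convergent (\<lambda>n. F (k n) w)" if w: "w \<in> CX" for w
  proof -
    have "Cauchy (\<lambda>n. F (k n) w)"
    proof (rule metric_CauchyI)
      fix e :: real assume "e > 0"
      \<comment> \<open>Convergence on the dense set \<open>S\<close> spreads to all of
        \<open>CX\<close> by splitting the error into three. The \<open>+ 1\<close> covers
        \<open>L = 0\<close> and makes \<open>L * d\<close> strictly smaller than
        \<open>e / 3\<close>.\<close>
      define d where "d = e / (3 * (L + 1))"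
      have "d > 0" using \<open>e > 0\<close> L by (simp add: d_def)
      then obtain s where s: "s \<in> S" "dist s w < d"
        using w S(3) unfolding closure_approachable subset_iff by blast
      have "s \<in> CX" using s S by blast
      have "\<forall>\<^sub>F n in sequentially. dist (c n *\<^sub>R x w n) (c n *\<^sub>R x s n) < d"
        using order_tendstoD(2)[OF dist_x[OF w \<open>s \<in> CX\<close>]] s(2) by (simp add: dist_commute)
      then obtain N1 where N1: "\<And>n. n \<ge> N1 \<Longrightarrow> dist (c n *\<^sub>R x w n) (c n *\<^sub>R x s n) < d"
        unfolding eventually_sequentially by blast
      have close: "dist (F (k n) w) (F (k n) s) < e / 3" if "n \<ge> N1" for n
      proof -
        have "k n \<ge> N1" using that seq_suble[OF k(1), of n] by simp
        have "dist (F (k n) w) (F (k n) s) \<le> L * dist (c (k n) *\<^sub>R x w (k n)) (c (k n) *\<^sub>R x s (k n))"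
          unfolding F_def by (intro F_le x w \<open>s \<in> CX\<close>)
        also have "\<dots> \<le> L * d" using N1[OF \<open>k n \<ge> N1\<close>] L by (intro mult_left_mono) auto
        also have "\<dots> < (L + 1) * d" using \<open>d > 0\<close> by simp
        also have "\<dots> = e / 3" using L by (simp add: d_def field_simps)
        finally show ?thesis .
      qed
      have "Cauchy (\<lambda>n. F (k n) s)" using k(2)[OF s(1)] by (rule convergent_Cauchy)
      from metric_CauchyD[OF this, of "e / 3"] \<open>e > 0\<close>
      obtain N2 where N2: "\<And>m n. m \<ge> N2 \<Longrightarrow> n \<ge> N2 \<Longrightarrow> dist (F (k m) s) (F (k n) s) < e / 3" by auto
      have "dist (F (k m) w) (F (k n) w) < e" if "m \<ge> max N1 N2" "n \<ge> max N1 N2" for m n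
        using close[of m] close[of n] N2[of m n] that
          dist_triangle[of "F (k m) w" "F (k n) w" "F (k m) s"] dist_triangle[of "F (k m) s" "F (k n) w" "F (k n) s"]
        by (simp add: dist_commute)
      then show "\<exists>M. \<forall>m\<ge>M. \<forall>n\<ge>M. dist (F (k m) w) (F (k n) w) < e" by blast
    qed
    then show ?thesis by (simp add: Cauchy_convergent_iff)
  qed
  define h where "h w = lim (\<lambda>n. F (k n) w)" for w
  have h: "(\<lambda>n. F (k n) w) \<longlonglongrightarrow> h w" if "w \<in> CX" for w
    using conv[OF that] by (simp add: h_def convergent_LIMSEQ_iff)
  have dist_x_k: "(\<lambda>n. dist (c (k n) *\<^sub>R x w (k n)) (c (k n) *\<^sub>R x w' (k n))) \<longlonglongrightarrow> dist w w'"
    if "w \<in> CX" "w' \<in> CX" for w w'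
    using LIMSEQ_subseq_LIMSEQ[OF dist_x[OF that] k(1)] by (simp add: o_def)
  have k_top: "filterlim (\<lambda>n. real (Suc (k n))) at_top sequentially"
    using filterlim_compose[OF filterlim_real_Suc filterlim_subseq[OF k(1)]] .
  show ?thesis
  proof (rule bilipschitz_homeomorphicI[of h CX CY L L'])
    show "dist (h w) (h w') \<le> L * dist w w'" if "w \<in> CX" "w' \<in> CX" for w w'
    proof (rule LIMSEQ_le[OF tendsto_dist[OF h h] tendsto_mult[OF tendsto_const dist_x_k]])
      show "\<exists>N. \<forall>n\<ge>N. dist (F (k n) w) (F (k n) w') \<le> L * dist (c (k n) *\<^sub>R x w (k n)) (c (k n) *\<^sub>R x w' (k n))"
        unfolding F_def using F_le x that by blast
    qed (use that in auto)
    show "dist w w' \<le> L' * dist (h w) (h w')" if "w \<in> CX" "w' \<in> CX" for w w'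
    proof (rule LIMSEQ_le[OF dist_x_k tendsto_mult[OF tendsto_const tendsto_dist[OF h h]]])
      show "\<exists>N. \<forall>n\<ge>N. dist (c (k n) *\<^sub>R x w (k n)) (c (k n) *\<^sub>R x w' (k n)) \<le> L' * dist (F (k n) w) (F (k n) w')"
        unfolding F_def using F_ge x that by blast
    qed (use that in auto)
    show "h ` CX = CY"
    proof
      show "h ` CX \<subseteq> CY"
      proof
        fix u assume "u \<in> h ` CX"
        then obtain w where w: "w \<in> CX" "u = h w" by blast
        show "u \<in> CY"
        proof (rule limY[OF k_top])
          show "f (x w (k j)) \<in> Y" for j using fY(1) x(1) w by blast
          show "(\<lambda>j. (1 / real (Suc (k j))) *\<^sub>R f (x w (k j))) \<longlonglongrightarrow> u"
            using h[OF w(1)] w(2) by (simp add: F_def c_def)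
        qed
      qed
      \<comment> \<open>Pointwise limits need not inherit surjectivity. Points approximating
        \<open>u\<close> are pulled back to \<open>X\<close>; their rescalings are bounded and
        subconverge to some \<open>w\<close> in \<open>CX\<close>, and comparison with the points
        chosen for \<open>w\<close> gives \<open>h w = u\<close>. The further subsequence
        \<open>r\<close> is harmless because \<open>h w\<close> is already a limit along
        \<open>k\<close>.\<close>
      show "CY \<subseteq> h ` CX"
      proof
        fix u assume u: "u \<in> CY"
        have "Y \<noteq> {}" using fY(1) x0 by blast
        then have "\<exists>y. (\<forall>n. y n \<in> Y) \<and> (\<lambda>n. (1 / real (Suc n)) *\<^sub>R y n) \<longlonglongrightarrow> u"
          by (intro rescaled_sequence_tendsto approxY u)
        then obtain y where y: "\<forall>n. y n \<in> Y" "(\<lambda>n. (1 / real (Suc n)) *\<^sub>R y n) \<longlonglongrightarrow> u"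
          by (elim exE conjE)
        have yl: "(\<lambda>n. c (k n) *\<^sub>R y (k n)) \<longlonglongrightarrow> u"
          using LIMSEQ_subseq_LIMSEQ[OF y(2) k(1)] by (simp add: o_def c_def)
        define z where "z n = g (y n)" for n
        have z: "z n \<in> X" "f (z n) = y n" for n using gX y(1) by (simp_all add: z_def)
        have "bounded (range (\<lambda>n. c (k n) *\<^sub>R z (k n)))"
        proof -
          define B where "B n = L' * dist (c (k n) *\<^sub>R y (k n)) (c (k n) *\<^sub>R f x0) + norm (c (k n) *\<^sub>R x0)" for n
          have ck: "(\<lambda>n. c (k n)) \<longlonglongrightarrow> 0" using LIMSEQ_subseq_LIMSEQ[OF c0 k(1)] by (simp add: o_def)
          have "B \<longlonglongrightarrow> L' * dist u (0 *\<^sub>R f x0) + norm (0 *\<^sub>R x0)"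
            unfolding B_def[abs_def] by (intro tendsto_intros yl ck)
          then have "Bseq B" using convergent_imp_Bseq convergentI by blast
          moreover have "norm (c (k n) *\<^sub>R z (k n)) \<le> norm (B n)" for n
          proof -
            have "norm (c (k n) *\<^sub>R z (k n)) \<le> dist (c (k n) *\<^sub>R z (k n)) (c (k n) *\<^sub>R x0) + norm (c (k n) *\<^sub>R x0)"
              using norm_triangle_ineq[of "c (k n) *\<^sub>R z (k n) - c (k n) *\<^sub>R x0" "c (k n) *\<^sub>R x0"] by (simp add: dist_norm)
            also have "\<dots> \<le> B n" using F_ge[OF z(1) x0, of "k n" "k n"] by (simp add: B_def z(2))
            finally show ?thesis by simp
          qed
          then have "\<forall>\<^sub>F n in sequentially. norm (c (k n) *\<^sub>R z (k n)) \<le> norm (B n)" by simp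
          ultimately have "Bseq (\<lambda>n. c (k n) *\<^sub>R z (k n))" by (rule Bseq_eventually_mono[rotated])
          then show ?thesis by (simp add: Bseq_eq_bounded)
        qed
        then obtain w r where r: "strict_mono (r :: nat \<Rightarrow> nat)" "((\<lambda>n. c (k n) *\<^sub>R z (k n)) \<circ> r) \<longlonglongrightarrow> w"
          using bounded_imp_convergent_subsequence by blast
        have "w \<in> CX"
        proof (rule limX)
          show "filterlim (\<lambda>n. real (Suc (k (r n)))) at_top sequentially"
            using filterlim_compose[OF k_top filterlim_subseq[OF r(1)]] .
          show "z (k (r n)) \<in> X" for n by (rule z)
          show "(\<lambda>n. (1 / real (Suc (k (r n)))) *\<^sub>R z (k (r n))) \<longlonglongrightarrow> w"
            using r(2) by (simp add: o_def c_def)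
        qed
        have "(\<lambda>n. c (k (r n)) *\<^sub>R x w (k (r n))) \<longlonglongrightarrow> w"
          using LIMSEQ_subseq_LIMSEQ[OF LIMSEQ_subseq_LIMSEQ[OF x(2)[OF \<open>w \<in> CX\<close>] k(1)] r(1)] by (simp add: o_def)
        then have "(\<lambda>n. L * dist (c (k (r n)) *\<^sub>R x w (k (r n))) (c (k (r n)) *\<^sub>R z (k (r n)))) \<longlonglongrightarrow> L * dist w w"
          using r(2) by (intro tendsto_intros) (auto simp: o_def)
        moreover have "(\<lambda>n. dist (F (k (r n)) w) (c (k (r n)) *\<^sub>R y (k (r n)))) \<longlonglongrightarrow> dist (h w) u"
          using LIMSEQ_subseq_LIMSEQ[OF h[OF \<open>w \<in> CX\<close>] r(1)] LIMSEQ_subseq_LIMSEQ[OF yl r(1)]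
          by (intro tendsto_dist) (auto simp: o_def)
        moreover have "dist (F (k (r n)) w) (c (k (r n)) *\<^sub>R y (k (r n))) \<le>
            L * dist (c (k (r n)) *\<^sub>R x w (k (r n))) (c (k (r n)) *\<^sub>R z (k (r n)))" for n
          using F_le[OF x(1)[OF \<open>w \<in> CX\<close>] z(1)] by (simp add: F_def flip: z(2))
        ultimately have "dist (h w) u \<le> L * dist w w" using LIMSEQ_le by blast
        then show "u \<in> h ` CX" using \<open>w \<in> CX\<close> by auto
      qed
    qed
  qed (use L in auto)
qed

theorem mainTheorem5:
  fixes A :: "(real ^ 'm) set" and B :: "(real ^ 'n) set"
  assumes "A \<in> semialgebraic" and "B \<in> semialgebraic"
    and "\<not> bounded A" and "\<not> bounded B"
    and "bilipschitz_homeomorphic_at_infinity A B"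
  shows "bilipschitz_homeomorphic (C_infinity A) (C_infinity B)"
proof -
  interpret A: conic_at_infinity A by (rule semialgebraic_conic_at_infinity) fact+
  interpret B: conic_at_infinity B by (rule semialgebraic_conic_at_infinity) fact+
  obtain K K' where K: "compact K" "compact K'" "bilipschitz_homeomorphic (A - K) (B - K')"
    using assms(5) unfolding bilipschitz_homeomorphic_at_infinity_def by blast
  \<comment> \<open>Removing a compact set does not affect the cone: its points are still
    approximated from \<open>A - K\<close>, and limits of rescaled points of \<open>A - K\<close>
    are limits for \<open>A\<close>. The same holds for \<open>B\<close>.\<close>
  show ?thesis
  proof (rule bilipschitz_homeomorphic_blow_down[OF _ _ _ _ _ K(3)])
    show "A - K \<noteq> {}"
      using assms(3) compact_imp_bounded[OF K(1)] bounded_subset[of K A] by blast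
    show "\<forall>\<^sub>F t in at_top. \<exists>x\<in>A - K. dist ((1 / t) *\<^sub>R x) w < e" if "w \<in> C_infinity A" "e > 0" for w e
      using A.eventually_approx_C_infinity_outside_compact[OF K(1) that] .
    show "\<forall>\<^sub>F t in at_top. \<exists>y\<in>B - K'. dist ((1 / t) *\<^sub>R y) w < e" if "w \<in> C_infinity B" "e > 0" for w e
      using B.eventually_approx_C_infinity_outside_compact[OF K(2) that] .
    show "w \<in> C_infinity A"
      if "filterlim t at_top sequentially" "\<And>j. x j \<in> A - K" "(\<lambda>j. (1 / t j) *\<^sub>R x j) \<longlonglongrightarrow> w" for t x w
      using A.limit_in_C_infinity[OF that(1) _ that(3)] that(2) by blast
    show "w \<in> C_infinity B"
      if "filterlim t at_top sequentially" "\<And>j. y j \<in> B - K'" "(\<lambda>j. (1 / t j) *\<^sub>R y j) \<longlonglongrightarrow> w" for t y w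
      using B.limit_in_C_infinity[OF that(1) _ that(3)] that(2) by blast
  qed
qed

end
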